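(* Let $H$ be an infinite dimensional separable Hilbert space and let $\mathcal{C}_1$ be the trace-class operators on $H$. Let $A\in\mathcal{C}_1$ be such that $\mathrm{Tr}(A)\ge 0$ and $\mathrm{Re}(A)\le S$ for some self-adjoint operator $S\in\mathcal{C}_1$, and let $\{A_n\}_{n=1}^\infty$ be a sequence in $B(H)$ such that $\mathrm{Tr}(SA_n)=0$, $\mathrm{Tr}(AA_n)=0$ and $\|A_n\|\le 1$ for each $n\ge 1$. Put $\alpha_0=\mathrm{Tr}(A)$ and $\alpha_n=\mathrm{Tr}(AA_n^* )$ for $n\ge 1$. Then $$\sum_{n=0}^\infty|\alpha_n|r^n\le \mathrm{Tr}(S)$$ whenever $0\le r\le \frac13$. Moreover, $\frac13$ is the optimal bound for $r$: for every $r>\frac13$ there exist $A\in\mathcal{C}_1$ with $\mathrm{Tr}(A)\ge 0$, a self-adjoint $S\in\mathcal{C}_1$ with $\mathrm{Re}(A)\le S$, and a sequence $\{A_n\}_{n=1}^\infty$ in $B(H)$ with $\mathrm{Tr}(SA_n)=0$, $\mathrm{Tr}(AA_n)=0$ and $\|A_n\|\le 1$ for each $n\ge 1$, for which the inequality $\sum_{n=0}^\infty|\alpha_n|r^n\le \mathrm{Tr}(S)$ (with $\alpha_0=\mathrm{Tr}(A)$ and $\alpha_n=\mathrm{Tr}(AA_n^* )$ for $n\ge 1$) fails.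
   Context: $\mathrm{Re}(A)=\frac12(A+A^* )$; $\le$ is the usual order on self-adjoint operators; $\mathrm{Tr}$ is the usual trace and $\|\cdot\|$ the operator norm. A divergent left-hand side counts as failure of the inequality. *)

theory Defs
  imports "HOL-Analysis.Analysis"
begin

text \<open>
  Complex Hilbert spaces. The inner product is linear in its first argument. The norm and topology
  come from the underlying real Hilbert space, whose inner product is the real part of the complex
  one; in particular positive definiteness of \<open>cinner\<close> is inherited from \<^class>\<open>real_inner\<close>.
\<close>

class complex_hilbert = real_inner + banach +
  fixes scaleC :: "complex \<Rightarrow> 'a \<Rightarrow> 'a"  (infixr \<open>*\<^sub>C\<close> 75)
    and cinner :: "'a \<Rightarrow> 'a \<Rightarrow> complex"
  assumes scaleC_add_right: "c *\<^sub>C (x + y) = c *\<^sub>C x + c *\<^sub>C y"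
    and scaleC_add_left: "(c + d) *\<^sub>C x = c *\<^sub>C x + d *\<^sub>C x"
    and scaleC_scaleC: "c *\<^sub>C (d *\<^sub>C x) = (c * d) *\<^sub>C x"
    and scaleC_of_real: "complex_of_real t *\<^sub>C x = t *\<^sub>R x"
    and cinner_add_left: "cinner (x + y) z = cinner x z + cinner y z"
    and cinner_scaleC_left: "cinner (c *\<^sub>C x) y = c * cinner x y"
    and cinner_commute: "cinner y x = cnj (cinner x y)"
    and Re_cinner: "Re (cinner x y) = inner x y"

lemma vector_space_scaleC:
  "vector_space (scaleC :: complex \<Rightarrow> 'h \<Rightarrow> 'h::complex_hilbert)"
proof
  show "1 *\<^sub>C x = x" for x :: 'h
    using scaleC_of_real[of 1 x] by simp
qed (simp_all add: scaleC_add_right scaleC_add_left scaleC_scaleC)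

lemma cinner_self: "cinner x x = complex_of_real ((norm x)\<^sup>2)" for x :: "'h::complex_hilbert"
proof (rule complex_eqI)
  show "Im (cinner x x) = Im (complex_of_real ((norm x)\<^sup>2))"
    using arg_cong[OF cinner_commute[of x x], of Im] by simp
qed (simp add: Re_cinner power2_norm_eq_inner)

abbreviation cspan :: "'h::complex_hilbert set \<Rightarrow> 'h set" where
  "cspan \<equiv> module.span scaleC"

definition is_onb :: "'h::complex_hilbert set \<Rightarrow> bool" where
  "is_onb E \<longleftrightarrow> (\<forall>e\<in>E. \<forall>f\<in>E. cinner e f = (if e = f then 1 else 0)) \<and> closure (cspan E) = UNIV"

text \<open>Membership in \<open>B(H)\<close>; the operator norm is the library's \<^const>\<open>onorm\<close>.\<close>

definition bounded_op :: "('h \<Rightarrow> 'h::complex_hilbert) \<Rightarrow> bool" where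
  "bounded_op A \<longleftrightarrow> bounded_linear A \<and> (\<forall>c x. A (c *\<^sub>C x) = c *\<^sub>C A x)"

definition cadjoint :: "('h \<Rightarrow> 'h::complex_hilbert) \<Rightarrow> 'h \<Rightarrow> 'h" where
  "cadjoint A = (THE B. \<forall>x y. cinner (A x) y = cinner x (B y))"

definition selfadjoint_op :: "('h \<Rightarrow> 'h::complex_hilbert) \<Rightarrow> bool" where
  "selfadjoint_op A \<longleftrightarrow> bounded_op A \<and> cadjoint A = A"

definition re_op :: "('h \<Rightarrow> 'h::complex_hilbert) \<Rightarrow> 'h \<Rightarrow> 'h" where
  "re_op A = (\<lambda>x. (1/2) *\<^sub>C (A x + cadjoint A x))"

definition positive_op :: "('h \<Rightarrow> 'h::complex_hilbert) \<Rightarrow> bool" where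
  "positive_op P \<longleftrightarrow> bounded_op P \<and> (\<forall>x. cinner (P x) x \<in> \<real> \<and> 0 \<le> Re (cinner (P x) x))"

definition op_le :: "('h \<Rightarrow> 'h::complex_hilbert) \<Rightarrow> ('h \<Rightarrow> 'h) \<Rightarrow> bool" where
  "op_le A B \<longleftrightarrow> positive_op (\<lambda>x. B x - A x)"

text \<open>\<open>P\<close> is the absolute value \<open>|A|\<close>, i.e. the (unique) positive square root of \<open>A\<^sup>*A\<close>.\<close>

definition is_abs_op :: "('h \<Rightarrow> 'h::complex_hilbert) \<Rightarrow> ('h \<Rightarrow> 'h) \<Rightarrow> bool" where
  "is_abs_op P A \<longleftrightarrow> positive_op P \<and> P \<circ> P = cadjoint A \<circ> A"

text \<open>
  \<open>A\<close> is of trace class iff \<open>|A|\<close> has finite trace; this does not depend on the orthonormal basis,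
  and neither does the trace of a trace-class operator.
\<close>

definition trace_class :: "('h \<Rightarrow> 'h::complex_hilbert) \<Rightarrow> bool" where
  "trace_class A \<longleftrightarrow> bounded_op A \<and>
     (\<exists>P E. is_abs_op P A \<and> is_onb E \<and> (\<lambda>e. cinner (P e) e) summable_on E)"

definition trace_op :: "('h \<Rightarrow> 'h::complex_hilbert) \<Rightarrow> complex" where
  "trace_op A = (\<Sum>\<^sub>\<infinity>e\<in>(SOME E. is_onb E). cinner (A e) e)"

text \<open>The sequence of operators is indexed from 1; its value at 0 is irrelevant.\<close>

definition bohr_hyps ::
    "('h \<Rightarrow> 'h::complex_hilbert) \<Rightarrow> ('h \<Rightarrow> 'h) \<Rightarrow> (nat \<Rightarrow> 'h \<Rightarrow> 'h) \<Rightarrow> bool" where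
  "bohr_hyps A S An \<longleftrightarrow>
     trace_class A \<and> trace_op A \<in> \<real> \<and> 0 \<le> Re (trace_op A) \<and>
     trace_class S \<and> selfadjoint_op S \<and> op_le (re_op A) S \<and>
     (\<forall>n\<ge>1. bounded_op (An n) \<and> trace_op (S \<circ> An n) = 0 \<and> trace_op (A \<circ> An n) = 0 \<and>
        onorm (An n) \<le> 1)"

definition bohr_coeff ::
    "('h \<Rightarrow> 'h::complex_hilbert) \<Rightarrow> (nat \<Rightarrow> 'h \<Rightarrow> 'h) \<Rightarrow> nat \<Rightarrow> complex" where
  "bohr_coeff A An n = (if n = 0 then trace_op A else trace_op (A \<circ> cadjoint (An n)))"

text \<open>
  A divergent left-hand side counts as failure. The trace of the self-adjoint operator \<open>S\<close> is real,
  so taking its real part loses nothing.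
\<close>

definition bohr_ineq ::
    "('h \<Rightarrow> 'h::complex_hilbert) \<Rightarrow> ('h \<Rightarrow> 'h) \<Rightarrow> (nat \<Rightarrow> 'h \<Rightarrow> 'h) \<Rightarrow> real \<Rightarrow> bool" where
  "bohr_ineq A S An r \<longleftrightarrow>
     summable (\<lambda>n. cmod (bohr_coeff A An n) * r ^ n) \<and>
     (\<Sum>n. cmod (bohr_coeff A An n) * r ^ n) \<le> Re (trace_op S)"

end

theory Submission
  imports Defs
begin

text \<open>
  Put \<open>P = S - Re A \<ge> 0\<close>. Taking adjoints in \<open>Tr (S A\<^sub>n) = Tr (A A\<^sub>n) = 0\<close> gives
  \<open>Tr (P A\<^sub>n\<^sup>*) = - \<alpha>\<^sub>n / 2\<close>, so \<open>\<bar>\<alpha>\<^sub>n\<bar> \<le> 2 Tr P = 2 (Tr S - \<alpha>\<^sub>0)\<close>, and summing the geometric series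
  gives the bound, because \<open>2 r / (1 - r) \<le> 1\<close> for \<open>r \<le> 1/3\<close>.

  Everything about traces is read off from expansions \<open>A = \<Sum>\<^sub>k |u\<^sub>k\<rangle>\<langle>v\<^sub>k|\<close> with
  \<open>\<Sum>\<^sub>k \<parallel>u\<^sub>k\<parallel> \<parallel>v\<^sub>k\<parallel> < \<infinity>\<close>, for which \<open>Tr A = \<Sum>\<^sub>k \<langle>u\<^sub>k, v\<^sub>k\<rangle>\<close> in every orthonormal basis. A positive
  operator of finite trace has such an expansion with \<open>u = v\<close> by Cholesky elimination along the basis,
  and a general trace-class operator inherits one from \<open>|A|\<close>, since \<open>\<parallel>A x\<parallel> = \<parallel>|A| x\<parallel>\<close>.
\<close>

section \<open>Inner products and adjoints\<close>

interpretation cvs: vector_space "scaleC :: complex \<Rightarrow> 'h \<Rightarrow> 'h::complex_hilbert"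
  by (rule vector_space_scaleC)

lemma cinner_add_right: "cinner x (y + z) = cinner x y + cinner x z"
  by (metis cinner_add_left cinner_commute complex_cnj_add)

lemma cinner_scaleC_right: "cinner x (c *\<^sub>C y) = cnj c * cinner x y"
  by (metis cinner_commute cinner_scaleC_left complex_cnj_mult)

lemma cinner_scaleR_left: "cinner (t *\<^sub>R x) y = of_real t * cinner x y"
  by (metis cinner_scaleC_left scaleC_of_real)

lemma cinner_scaleR_right: "cinner x (t *\<^sub>R y) = of_real t * cinner x y"
  by (metis cinner_scaleC_right scaleC_of_real complex_cnj_complex_of_real)

text \<open>The class axioms tie the norm to real scalars only. The complex case follows from
  \<open>cinner_self\<close>, because scaling both arguments multiplies \<open>cinner x x\<close> by
  \<open>c * cnj c\<close>.\<close>

lemma norm_scaleC [simp]: "norm (c *\<^sub>C x) = cmod c * norm x"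
proof -
  have "complex_of_real ((norm (c *\<^sub>C x))\<^sup>2) = (c * cnj c) * cinner x x"
    unfolding cinner_self[symmetric] by (simp add: cinner_scaleC_left cinner_scaleC_right)
  also have "\<dots> = complex_of_real ((cmod c * norm x)\<^sup>2)"
    unfolding cinner_self by (simp add: power_mult_distrib flip: complex_norm_square)
  finally have "complex_of_real ((norm (c *\<^sub>C x))\<^sup>2) = complex_of_real ((cmod c * norm x)\<^sup>2)" .
  hence "(norm (c *\<^sub>C x))\<^sup>2 = (cmod c * norm x)\<^sup>2"
    by (simp only: of_real_eq_iff)
  thus ?thesis by simp
qed

text \<open>A unimodular factor rotates \<open>cinner x y\<close> onto the positive real axis, where
  the real Cauchy-Schwarz inequality applies.\<close>

lemma norm_cinner_le: "cmod (cinner x y) \<le> norm x * norm y"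
proof (cases "cinner x y = 0")
  case False
  define c where "c = cnj (cinner x y) / cmod (cinner x y)"
  have "cmod c = 1" using False by (simp add: c_def norm_divide)
  have "c * cinner x y = cmod (cinner x y)"
    using False complex_norm_square[of "cinner x y"]
    by (simp add: c_def field_simps power2_eq_square)
  hence "cmod (cinner x y) = Re (cinner (c *\<^sub>C x) y)"
    by (simp add: cinner_scaleC_left)
  also have "\<dots> \<le> norm (c *\<^sub>C x) * norm y"
    unfolding Re_cinner by (rule norm_cauchy_schwarz)
  finally show ?thesis using \<open>cmod c = 1\<close> by simp
qed simp

lemma bounded_linear_cinner_left: "bounded_linear (\<lambda>x. cinner x y)"
  by (rule bounded_linear_intro[where K = "norm y"])
    (simp_all add: cinner_add_left cinner_scaleR_left scaleR_conv_of_real norm_cinner_le)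

lemma bounded_linear_cinner_right: "bounded_linear (\<lambda>y. cinner x y)"
  by (rule bounded_linear_intro[where K = "norm x"])
    (simp_all add: cinner_add_right cinner_scaleR_right scaleR_conv_of_real norm_cinner_le mult.commute[of _ "norm x"])

lemmas cinner_diff_left = linear_diff[OF bounded_linear.linear[OF bounded_linear_cinner_left]]
lemmas cinner_diff_right = linear_diff[OF bounded_linear.linear[OF bounded_linear_cinner_right]]

lemmas cinner_simps =
  cinner_add_left cinner_add_right cinner_scaleC_left cinner_scaleC_right
  cinner_scaleR_left cinner_scaleR_right
  cinner_diff_left cinner_diff_right
  linear_sum[OF bounded_linear.linear[OF bounded_linear_cinner_left]]
  linear_sum[OF bounded_linear.linear[OF bounded_linear_cinner_right]]
  linear_0[OF bounded_linear.linear[OF bounded_linear_cinner_left]]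
  linear_0[OF bounded_linear.linear[OF bounded_linear_cinner_right]]

lemma cinner_eq_zero_commute: "cinner x y = 0 \<longleftrightarrow> cinner y x = 0"
  by (metis cinner_commute complex_cnj_zero)

lemma cinner_ext_left:
  assumes "\<And>x. cinner x y = cinner x z"
  shows "y = z"
proof -
  have "cinner (y - z) (y - z) = 0" using assms[of "y - z"] by (simp add: cinner_simps)
  thus ?thesis by (simp add: cinner_self)
qed

lemma bounded_linear_scaleC: "bounded_linear (\<lambda>x. c *\<^sub>C (x::'h::complex_hilbert))"
proof (rule bounded_linear_intro[where K = "cmod c"])
  show "c *\<^sub>C r *\<^sub>R x = r *\<^sub>R c *\<^sub>C x" for r and x :: 'h
    by (simp only: scaleC_of_real[symmetric] scaleC_scaleC mult.commute)
qed (simp_all add: scaleC_add_right)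

lemma bounded_linear_scaleC_left: "bounded_linear (\<lambda>c. c *\<^sub>C (x::'h::complex_hilbert))"
proof (rule bounded_linear_intro[where K = "norm x"])
  show "(r *\<^sub>R c) *\<^sub>C x = r *\<^sub>R c *\<^sub>C x" for r c
    by (simp only: scaleC_of_real[symmetric] scaleC_scaleC scaleR_conv_of_real)
qed (simp_all add: scaleC_add_left)

text \<open>Riesz representation and orthogonal projection are both obtained by minimising
  \<open>\<parallel>x\<parallel>\<^sup>2 - 2 f x\<close> over \<open>M\<close>; the parallelogram law makes a minimising sequence Cauchy.\<close>

lemma riesz_closed_subspace:
  fixes f :: "'a::{real_inner,banach} \<Rightarrow> real"
  assumes f: "bounded_linear f" and M: "subspace M" "closed M"
  obtains b where "b \<in> M" "\<And>x. x \<in> M \<Longrightarrow> f x = inner x b"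
proof -
  interpret f: bounded_linear f by (rule f)
  obtain K where K: "\<And>x. norm (f x) \<le> norm x * K" using f.bounded by blast
  define J where "J x = (norm x)\<^sup>2 - 2 * f x" for x
  \<comment> \<open>Complete the square, using that \<open>f x\<close> is at most
    \<open>K * norm x\<close>.\<close>
  have J_lower: "- K\<^sup>2 \<le> J x" for x
  proof -
    have "0 \<le> (norm x - K)\<^sup>2" by simp
    thus ?thesis using K[of x] by (simp add: J_def power2_eq_square algebra_simps)
  qed
  define m where "m = Inf (J ` M)"
  have bdd: "bdd_below (J ` M)" using J_lower by (auto intro!: bdd_belowI[where m = "- K\<^sup>2"])
  have ne: "J ` M \<noteq> {}" using subspace_0[OF M(1)] by blast
  have m_le: "m \<le> J x" if "x \<in> M" for x
    unfolding m_def using that bdd by (simp add: cInf_lower)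
  have "\<exists>x\<in>M. J x < m + 1 / Suc n" for n
    using cInf_lessD[OF ne, of "m + 1 / Suc n"] by (auto simp: m_def)
  then obtain X where XM: "\<And>n. X n \<in> M" and XJ: "\<And>n. J (X n) < m + 1 / Suc n" by metis
  \<comment> \<open>The midpoint lies in \<open>M\<close>, so \<open>J\<close> is at least
    \<open>m\<close> there; the parallelogram law turns this into a bound on the distance.\<close>
  have par: "(norm (x - y))\<^sup>2 \<le> 2 * (J x - m) + 2 * (J y - m)" if "x \<in> M" "y \<in> M" for x y
  proof -
    have "(1/2) *\<^sub>R (x + y) \<in> M"
      using that M(1) by (intro subspace_mul subspace_add)
    hence "m \<le> J ((1/2) *\<^sub>R (x + y))" by (rule m_le)
    also have "J ((1/2) *\<^sub>R (x + y)) = (norm (x + y))\<^sup>2 / 4 - f x - f y"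
      unfolding J_def norm_scaleR f.scaleR f.add by (simp add: power_mult_distrib power_divide field_simps)
    finally show ?thesis
      by (simp add: J_def power2_norm_eq_inner inner_simps inner_commute algebra_simps)
  qed
  have "Cauchy X"
  proof (rule metric_CauchyI)
    fix e :: real assume "e > 0"
    then obtain N where N: "4 / e\<^sup>2 < Suc N" using reals_Archimedean2
      by (metis lessI of_nat_less_iff order_less_trans)
    have "dist (X i) (X j) < e" if "i \<ge> N" "j \<ge> N" for i j
    proof -
      have inv: "1 / Suc k \<le> 1 / Suc N" if "k \<ge> N" for k
        using that by (simp add: frac_le)
      have "(norm (X i - X j))\<^sup>2 < 4 * (1 / Suc N)"
        using par[OF XM XM, of i j] XJ[of i] XJ[of j] inv[OF that(1)] inv[OF that(2)]
        by argo
      also have "\<dots> < e\<^sup>2"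
        using N \<open>e > 0\<close> by (simp add: field_simps)
      finally show ?thesis
        using \<open>e > 0\<close> by (simp add: dist_norm power_less_imp_less_base)
    qed
    thus "\<exists>N. \<forall>i\<ge>N. \<forall>j\<ge>N. dist (X i) (X j) < e" by blast
  qed
  then obtain b where b: "X \<longlonglongrightarrow> b" using Cauchy_convergent_iff convergent_def by blast
  have "b \<in> M" using M(2) XM b closed_sequentially by blast
  have "(\<lambda>n. J (X n)) \<longlonglongrightarrow> J b"
    unfolding J_def by (intro tendsto_intros f.tendsto b)
  moreover have "(\<lambda>n. m + 1 / Suc n) \<longlonglongrightarrow> m + 0"
    by (intro tendsto_add tendsto_const LIMSEQ_Suc[OF lim_1_over_n])
  ultimately have Jb: "J b \<le> m"
    using LIMSEQ_le[of "\<lambda>n. J (X n)" "J b" "\<lambda>n. m + 1 / Suc n" "m + 0"] XJ less_imp_le by auto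
  have "f x = inner x b" if "x \<in> M" for x
  proof -
    define d where "d = f x - inner x b"
    define N where "N = (norm x)\<^sup>2"
    have N: "N \<ge> 0" by (simp add: N_def)
    \<comment> \<open>First variation of \<open>J\<close> at its minimiser \<open>b\<close> in the
      direction \<open>x\<close>.\<close>
    have quad: "2 * t * d \<le> t\<^sup>2 * N" for t
    proof -
      have "b + t *\<^sub>R x \<in> M" using that \<open>b \<in> M\<close> M(1) by (intro subspace_mul subspace_add)
      hence "J b \<le> J (b + t *\<^sub>R x)" using Jb m_le by fastforce
      thus ?thesis
        unfolding J_def d_def N_def power2_norm_eq_inner
        by (simp add: f.add f.scaleR inner_simps inner_commute power2_eq_square algebra_simps)
    qed
    \<comment> \<open>The choice \<open>t = d / (N+1)\<close> avoids a division by zero when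
      \<open>x = 0\<close>.\<close>
    have "2 * d\<^sup>2 / (N+1) \<le> d\<^sup>2 * N / (N+1)\<^sup>2"
      using quad[of "d / (N+1)"] by (simp add: power2_eq_square mult_ac)
    hence "2 * d\<^sup>2 * (N+1) \<le> d\<^sup>2 * N"
      using N by (simp add: divide_simps power2_eq_square)
    hence "d\<^sup>2 * (N+2) \<le> 0" by (simp add: algebra_simps)
    hence "d = 0" using N by (simp add: mult_le_0_iff)
    thus ?thesis by (simp add: d_def)
  qed
  thus ?thesis using that \<open>b \<in> M\<close> by blast
qed

text \<open>Multiplying the argument by \<i> exposes the imaginary part of \<open>f\<close>, so the
  vector that represents the real part represents all of \<open>f\<close>.\<close>

lemma riesz_complex:
  fixes f :: "'h::complex_hilbert \<Rightarrow> complex"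
  assumes f: "bounded_linear f" and fC: "\<And>c x. f (c *\<^sub>C x) = c * f x"
  obtains b where "\<And>x. f x = cinner x b"
proof -
  have "bounded_linear (\<lambda>x. Re (f x))"
    using bounded_linear_compose[OF bounded_linear_Re f] .
  then obtain b where b: "\<And>x. Re (f x) = inner x b"
    using riesz_closed_subspace[of "\<lambda>x. Re (f x)" UNIV] by auto
  have "f x = cinner x b" for x
  proof (rule complex_eqI)
    show "Re (f x) = Re (cinner x b)" by (simp add: b Re_cinner)
    have "Re (f (\<i> *\<^sub>C x)) = Re (cinner (\<i> *\<^sub>C x) b)" by (simp only: b Re_cinner)
    thus "Im (f x) = Im (cinner x b)" by (simp add: fC cinner_scaleC_left)
  qed
  thus ?thesis using that by blast
qed

section \<open>Bounded operators and their adjoints\<close>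

lemma bounded_opD:
  assumes "bounded_op A"
  shows "bounded_linear A" "A (c *\<^sub>C x) = c *\<^sub>C A x"
  using assms by (auto simp: bounded_op_def)

lemma bounded_op_simps:
  assumes "bounded_op A"
  shows "A (x + y) = A x + A y" "A (x - y) = A x - A y" "A 0 = 0" "A (t *\<^sub>R x) = t *\<^sub>R A x"
    "A (c *\<^sub>C x) = c *\<^sub>C A x" "A (sum g I) = (\<Sum>i\<in>I. A (g i))"
  using bounded_opD[OF assms] linear_add linear_diff linear_0 linear_scale linear_sum
    bounded_linear.linear by metis+

lemma bounded_op_diff: "bounded_op A \<Longrightarrow> bounded_op B \<Longrightarrow> bounded_op (\<lambda>x. A x - B x)"
  by (auto simp: bounded_op_def bounded_linear_sub cvs.scale_right_diff_distrib)

lemma bounded_op_rank_one: "bounded_op (\<lambda>x. cinner x v *\<^sub>C w)"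
  unfolding bounded_op_def
  using bounded_linear_compose[OF bounded_linear_scaleC_left bounded_linear_cinner_left]
  by (auto simp: cinner_scaleC_left scaleC_scaleC)

text \<open>\<open>cadjoint\<close> is a definite description, so concrete adjoints are computed by
  checking the adjoint identity for a candidate.\<close>

lemma cadjoint_unique:
  assumes "\<And>x y. cinner (A x) y = cinner x (B y)"
  shows "cadjoint A = B"
  unfolding cadjoint_def
proof (rule the_equality)
  fix C assume C: "\<forall>x y. cinner (A x) y = cinner x (C y)"
  show "C = B"
  proof
    fix y show "C y = B y" by (rule cinner_ext_left) (simp flip: assms C[rule_format])
  qed
qed (use assms in blast)

text \<open>Riesz representation of each functional sending \<open>x\<close> to
  \<open>cinner (A x) y\<close> supplies the map that the description of \<open>cadjoint\<close>
  needs.\<close>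

lemma cinner_cadjoint_right:
  assumes A: "bounded_op A"
  shows "cinner (A x) y = cinner x (cadjoint A y)"
proof -
  have "\<exists>b. \<forall>x. cinner (A x) y = cinner x b" for y
  proof -
    have "bounded_linear (\<lambda>x. cinner (A x) y)"
      using bounded_linear_compose[OF bounded_linear_cinner_left bounded_opD(1)[OF A]] .
    moreover have "cinner (A (c *\<^sub>C x)) y = c * cinner (A x) y" for c x
      by (simp add: bounded_opD(2)[OF A] cinner_scaleC_left)
    ultimately obtain b where "\<And>x. cinner (A x) y = cinner x b"
      using riesz_complex[of "\<lambda>x. cinner (A x) y"] by blast
    thus ?thesis by blast
  qed
  then obtain B where "\<And>x y. cinner (A x) y = cinner x (B y)" by metis
  thus ?thesis using cadjoint_unique by metis
qed

lemma cinner_cadjoint_left: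
  assumes A: "bounded_op A"
  shows "cinner (cadjoint A x) y = cinner x (A y)"
  using arg_cong[OF cinner_cadjoint_right[OF A, of y x], of cnj] by (simp flip: cinner_commute)

text \<open>With \<open>y = cadjoint A x\<close>, the square of \<open>norm y\<close> is
  \<open>cinner (A y) x\<close>, and one factor \<open>norm y\<close> cancels.\<close>

lemma norm_cadjoint_le:
  assumes A: "bounded_op A"
  shows "norm (cadjoint A x) \<le> onorm A * norm x"
proof (cases "cadjoint A x = 0")
  case False
  let ?y = "cadjoint A x"
  have "(norm ?y)\<^sup>2 = cmod (cinner ?y ?y)" unfolding cinner_self norm_of_real by simp
  also have "\<dots> = cmod (cinner (A ?y) x)" by (simp add: cinner_cadjoint_right[OF A])
  also have "\<dots> \<le> norm (A ?y) * norm x" by (rule norm_cinner_le)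
  also have "\<dots> \<le> onorm A * norm ?y * norm x"
    by (intro mult_right_mono onorm bounded_opD[OF A]) simp
  finally have "norm ?y * norm ?y \<le> norm ?y * (onorm A * norm x)"
    by (simp add: power2_eq_square mult_ac)
  thus ?thesis using False by simp
qed (simp add: onorm_pos_le[OF bounded_opD(1)[OF A]])

lemma bounded_op_cadjoint:
  assumes A: "bounded_op A"
  shows "bounded_op (cadjoint A)"
proof -
  have add: "cadjoint A (x + y) = cadjoint A x + cadjoint A y" for x y
    by (rule cinner_ext_left) (simp add: cinner_simps flip: cinner_cadjoint_right[OF A])
  have scale: "cadjoint A (c *\<^sub>C x) = c *\<^sub>C cadjoint A x" for c x
    by (rule cinner_ext_left) (simp add: cinner_simps flip: cinner_cadjoint_right[OF A])
  have "bounded_linear (cadjoint A)"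
  proof (rule bounded_linear_intro[where K = "onorm A"])
    show "cadjoint A (r *\<^sub>R x) = r *\<^sub>R cadjoint A x" for r x
      by (simp only: scaleC_of_real[symmetric] scale)
  qed (use norm_cadjoint_le[OF A] in \<open>simp_all add: add mult.commute[of "norm _"]\<close>)
  thus ?thesis using scale by (simp add: bounded_op_def)
qed

lemma onorm_cadjoint_le: "bounded_op A \<Longrightarrow> onorm (cadjoint A) \<le> onorm A"
  by (intro onorm_bound norm_cadjoint_le onorm_pos_le bounded_opD(1))

section \<open>Orthonormal bases and traces\<close>

definition orthonormal :: "'h::complex_hilbert set \<Rightarrow> bool" where
  "orthonormal E \<longleftrightarrow> (\<forall>e\<in>E. \<forall>f\<in>E. cinner e f = (if e = f then 1 else 0))"

lemma is_onb_iff: "is_onb E \<longleftrightarrow> orthonormal E \<and> closure (cspan E) = UNIV"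
  by (simp add: is_onb_def orthonormal_def)

lemma orthonormal_subset: "orthonormal E \<Longrightarrow> G \<subseteq> E \<Longrightarrow> orthonormal G"
  unfolding orthonormal_def by blast

lemma orthonormal_norm:
  assumes "orthonormal E" "e \<in> E"
  shows "norm e = 1"
proof -
  have "complex_of_real ((norm e)\<^sup>2) = 1"
    unfolding cinner_self[symmetric] using assms by (simp add: orthonormal_def)
  hence "(norm e)\<^sup>2 = 1" by (simp only: of_real_eq_1_iff)
  thus ?thesis using norm_ge_zero[of e] by (auto simp: power2_eq_1_iff)
qed

lemma orthogonal_cspan:
  assumes "\<And>e. e \<in> E \<Longrightarrow> cinner d e = 0" and "z \<in> cspan E"
  shows "cinner d z = 0"
  using assms(2) by (induction rule: cvs.span_induct_alt) (simp_all add: cinner_simps assms(1))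

lemma norm_add_orthogonal:
  assumes "cinner x y = 0"
  shows "(norm (x + y))\<^sup>2 = (norm x)\<^sup>2 + (norm y)\<^sup>2"
  using assms Re_cinner[of x y] by (simp add: power2_norm_eq_inner inner_simps inner_commute)

section \<open>Bessel's inequality, Fourier expansion and Parseval's identity\<close>

context
  fixes G :: "'h::complex_hilbert set"
  assumes on: "orthonormal G" and fin: "finite G"
begin

lemma cinner_fourier_diff:
  assumes "z \<in> cspan G"
  shows "cinner (x - (\<Sum>e\<in>G. cinner x e *\<^sub>C e)) z = 0"
proof (rule orthogonal_cspan[OF _ assms])
  fix e assume e: "e \<in> G"
  have "(\<Sum>f\<in>G. cinner x f * cinner f e) = (\<Sum>f\<in>G. if f = e then cinner x f else 0)"
    using on e by (intro sum.cong) (auto simp: orthonormal_def)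
  thus "cinner (x - (\<Sum>e\<in>G. cinner x e *\<^sub>C e)) e = 0"
    using fin e by (simp add: cinner_simps)
qed

lemma fourier_in_cspan: "(\<Sum>e\<in>G. cinner x e *\<^sub>C e) \<in> cspan G"
  by (intro cvs.span_sum cvs.span_scale cvs.span_base)

text \<open>Pythagoras: the residual is orthogonal to the span, which contains the difference
  between the Fourier sum and \<open>y\<close>.\<close>

lemma fourier_best_approximation:
  assumes "y \<in> cspan G"
  shows "norm (x - (\<Sum>e\<in>G. cinner x e *\<^sub>C e)) \<le> norm (x - y)"
proof -
  let ?p = "\<Sum>e\<in>G. cinner x e *\<^sub>C e"
  have "cinner (x - ?p) (?p - y) = 0"
    by (intro cinner_fourier_diff cvs.span_diff fourier_in_cspan assms)
  from norm_add_orthogonal[OF this] have "(norm (x - ?p))\<^sup>2 \<le> (norm (x - y))\<^sup>2" by simp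
  thus ?thesis by (rule power2_le_imp_le) simp
qed

lemma bessel: "(\<Sum>e\<in>G. (cmod (cinner x e))\<^sup>2) \<le> (norm x)\<^sup>2"
proof -
  let ?p = "\<Sum>e\<in>G. cinner x e *\<^sub>C e"
  have orth: "cinner (x - ?p) ?p = 0"
    by (intro cinner_fourier_diff fourier_in_cspan)
  hence "complex_of_real ((norm ?p)\<^sup>2) = cinner x ?p"
    unfolding cinner_self[symmetric] cinner_diff_left by simp
  also have "\<dots> = complex_of_real (\<Sum>e\<in>G. (cmod (cinner x e))\<^sup>2)"
    by (simp add: cinner_simps mult.commute flip: complex_norm_square)
  finally have "(norm ?p)\<^sup>2 = (\<Sum>e\<in>G. (cmod (cinner x e))\<^sup>2)"
    by (simp only: of_real_eq_iff)
  moreover have "(norm x)\<^sup>2 = (norm (x - ?p))\<^sup>2 + (norm ?p)\<^sup>2"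
    using norm_add_orthogonal[OF orth] by simp
  ultimately show ?thesis by simp
qed

text \<open>This bound, uniform in \<open>G\<close>, later makes the double sum behind the trace
  absolutely convergent.\<close>

lemma bessel_product: "(\<Sum>e\<in>G. cmod (cinner x e) * cmod (cinner e y)) \<le> norm x * norm y"
proof -
  have *: "L2_set (\<lambda>e. cmod (cinner z e)) G \<le> norm z" for z
    unfolding L2_set_def by (intro real_le_lsqrt bessel) auto
  have "cmod (cinner e y) = cmod (cinner y e)" for e
    by (metis cinner_commute complex_mod_cnj)
  hence "(\<Sum>e\<in>G. cmod (cinner x e) * cmod (cinner e y))
      \<le> L2_set (\<lambda>e. cmod (cinner x e)) G * L2_set (\<lambda>e. cmod (cinner y e)) G"
    using L2_set_mult_ineq[of "\<lambda>e. cmod (cinner x e)" "\<lambda>e. cmod (cinner y e)" G] by simp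
  also have "\<dots> \<le> norm x * norm y"
    by (intro mult_mono * L2_set_nonneg) auto
  finally show ?thesis .
qed

end

lemma cspan_finite_subset:
  assumes "y \<in> cspan E"
  obtains G where "finite G" "G \<subseteq> E" "y \<in> cspan G"
proof -
  obtain G r where "y = (\<Sum>a\<in>G. r a *\<^sub>C a)" "finite G" "G \<subseteq> E"
    using assms unfolding cvs.span_explicit[of E] by blast
  moreover from this have "y \<in> cspan G" by (auto intro: cvs.span_sum cvs.span_scale cvs.span_base)
  ultimately show ?thesis using that by blast
qed

text \<open>A nearby \<open>y\<close> in the span involves only a finite \<open>G\<close>. By best
  approximation, the Fourier sum over any finite superset of \<open>G\<close> is at least as close
  to \<open>x\<close>.\<close>

lemma fourier_has_sum:
  assumes E: "is_onb E"
  shows "((\<lambda>e. cinner x e *\<^sub>C e) has_sum x) E"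
  unfolding has_sum_def tendsto_iff eventually_finite_subsets_at_top
proof (intro allI impI)
  fix \<epsilon> :: real assume "\<epsilon> > 0"
  have on: "orthonormal E" and "x \<in> closure (cspan E)" using E by (auto simp: is_onb_iff)
  then obtain y where "y \<in> cspan E" and yx: "dist y x < \<epsilon>"
    using \<open>\<epsilon> > 0\<close> unfolding closure_approachable by blast
  then obtain G where G: "finite G" "G \<subseteq> E" "y \<in> cspan G" using cspan_finite_subset by blast
  show "\<exists>X. finite X \<and> X \<subseteq> E \<and>
      (\<forall>Y. finite Y \<and> X \<subseteq> Y \<and> Y \<subseteq> E \<longrightarrow> dist (\<Sum>e\<in>Y. cinner x e *\<^sub>C e) x < \<epsilon>)"
  proof (intro exI[of _ G] conjI allI impI G)
    fix Y assume Y: "finite Y \<and> G \<subseteq> Y \<and> Y \<subseteq> E"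
    hence "norm (x - (\<Sum>e\<in>Y. cinner x e *\<^sub>C e)) \<le> norm (x - y)"
      using G(3) cvs.span_mono[of G Y] orthonormal_subset[OF on]
      by (intro fourier_best_approximation) auto
    thus "dist (\<Sum>e\<in>Y. cinner x e *\<^sub>C e) x < \<epsilon>"
      using yx by (simp add: dist_norm norm_minus_commute)
  qed
qed

lemma parseval:
  assumes "is_onb E"
  shows "((\<lambda>e. cinner x e * cinner e y) has_sum cinner x y) E"
  using has_sum_bounded_linear[OF bounded_linear_cinner_left[of y] fourier_has_sum[OF assms, of x]]
  by (simp add: cinner_scaleC_left)

lemma parseval_abs_summable:
  assumes "is_onb E"
  shows "(\<lambda>e. norm (cinner x e * cinner e y)) summable_on E"
    and "(\<Sum>\<^sub>\<infinity>e\<in>E. norm (cinner x e * cinner e y)) \<le> norm x * norm y"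
proof -
  have *: "(\<Sum>e\<in>F. norm (cinner x e * cinner e y)) \<le> norm x * norm y"
    if "finite F" "F \<subseteq> E" for F
    using bessel_product[of F x y] that assms orthonormal_subset
    by (auto simp: is_onb_iff norm_mult)
  show "(\<lambda>e. norm (cinner x e * cinner e y)) summable_on E"
    by (rule nonneg_bdd_above_summable_on) (use * in \<open>auto intro!: bdd_aboveI\<close>)
  thus "(\<Sum>\<^sub>\<infinity>e\<in>E. norm (cinner x e * cinner e y)) \<le> norm x * norm y"
    using * by (rule infsum_le_finite_sums)
qed

section \<open>Existence of orthonormal bases\<close>

lemma real_subspace_if_complex: "cvs.subspace M \<Longrightarrow> subspace M"
  unfolding cvs.subspace_def subspace_def by (metis scaleC_of_real)

lemma subspace_closure:
  fixes M :: "'a::real_normed_vector set"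
  assumes M: "subspace M"
  shows "subspace (closure M)"
  unfolding subspace_def
proof (intro conjI ballI allI)
  show "0 \<in> closure M" using subspace_0[OF M] closure_subset by blast
next
  fix x y assume "x \<in> closure M" "y \<in> closure M"
  then obtain X Y where "\<And>n. X n \<in> M" "\<And>n. Y n \<in> M" "X \<longlonglongrightarrow> x" "Y \<longlonglongrightarrow> y"
    unfolding closure_sequential by blast
  hence "\<And>n. X n + Y n \<in> M" "(\<lambda>n. X n + Y n) \<longlonglongrightarrow> x + y"
    by (auto intro: subspace_add[OF M] tendsto_add)
  thus "x + y \<in> closure M" unfolding closure_sequential by (intro exI[of _ "\<lambda>n. X n + Y n"]) blast
next
  fix c :: real and x assume "x \<in> closure M"
  then obtain X where "\<And>n. X n \<in> M" "X \<longlonglongrightarrow> x"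
    unfolding closure_sequential by blast
  hence "\<And>n. c *\<^sub>R X n \<in> M" "(\<lambda>n. c *\<^sub>R X n) \<longlonglongrightarrow> c *\<^sub>R x"
    by (auto intro: subspace_mul[OF M] tendsto_scaleR)
  thus "c *\<^sub>R x \<in> closure M" unfolding closure_sequential by (intro exI[of _ "\<lambda>n. c *\<^sub>R X n"]) blast
qed

text \<open>Projecting \<open>x\<close> onto the closed span leaves a remainder orthogonal to
  \<open>E\<close>, which totality forces to vanish.\<close>

lemma is_onb_if_total:
  assumes on: "orthonormal E" and total: "\<And>x. (\<And>e. e \<in> E \<Longrightarrow> cinner e x = 0) \<Longrightarrow> x = 0"
  shows "is_onb E"
  unfolding is_onb_iff
proof (intro conjI on UNIV_eq_I[symmetric])
  fix x
  have "subspace (closure (cspan E))"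
    by (intro subspace_closure real_subspace_if_complex cvs.subspace_span)
  then obtain b where b: "b \<in> closure (cspan E)"
    and inner_b: "\<And>z. z \<in> closure (cspan E) \<Longrightarrow> inner z x = inner z b"
    using riesz_closed_subspace[OF bounded_linear_inner_left[of x], of "closure (cspan E)"] by auto
  have *: "Re (cinner z (x - b)) = 0" if "z \<in> cspan E" for z
    using inner_b[OF subsetD[OF closure_subset that]] by (simp add: Re_cinner inner_diff_right)
  \<comment> \<open>The real projection controls real parts only; testing with \<i> times
    \<open>e\<close> as well gives the imaginary part.\<close>
  have "cinner e (x - b) = 0" if "e \<in> E" for e
    using *[OF cvs.span_base[OF that]] *[OF cvs.span_scale[OF cvs.span_base[OF that], of "\<i>"]]
    by (simp add: complex_eq_iff cinner_scaleC_left)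
  hence "x - b = 0" by (rule total)
  thus "x \<in> closure (cspan E)" using b by simp
qed

text \<open>Zorn's lemma: a nonzero vector orthogonal to a maximal orthonormal set could be
  normalised and adjoined.\<close>

lemma orthonormal_extend_onb:
  assumes "orthonormal E\<^sub>0"
  obtains E where "E\<^sub>0 \<subseteq> E" "is_onb E"
proof -
  let ?\<A> = "{E. orthonormal E \<and> E\<^sub>0 \<subseteq> E}"
  have "\<exists>M\<in>?\<A>. \<forall>X\<in>?\<A>. M \<subseteq> X \<longrightarrow> X = M"
  proof (rule subset_Zorn_nonempty)
    show "?\<A> \<noteq> {}" using assms by blast
    fix \<C> assume ne: "\<C> \<noteq> {}" and ch: "subset.chain ?\<A> \<C>"
    have "orthonormal (\<Union>\<C>)"
      unfolding orthonormal_def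
    proof (intro ballI)
      fix e f assume "e \<in> \<Union>\<C>" "f \<in> \<Union>\<C>"
      then obtain X Y where "X \<in> \<C>" "Y \<in> \<C>" "e \<in> X" "f \<in> Y" by blast
      then obtain Z where "Z \<in> \<C>" "e \<in> Z" "f \<in> Z"
        using ch unfolding subset.chain_def by blast
      thus "cinner e f = (if e = f then 1 else 0)"
        using ch unfolding subset.chain_def orthonormal_def by blast
    qed
    thus "\<Union>\<C> \<in> ?\<A>" using ne ch unfolding subset.chain_def by blast
  qed
  then obtain E where E: "orthonormal E" "E\<^sub>0 \<subseteq> E"
    and max: "\<And>X. orthonormal X \<Longrightarrow> E\<^sub>0 \<subseteq> X \<Longrightarrow> E \<subseteq> X \<Longrightarrow> X = E"
    by (elim bexE) (metis (no_types, lifting) mem_Collect_eq)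
  have "is_onb E"
  proof (rule is_onb_if_total[OF E(1)], rule ccontr)
    fix x assume x: "\<And>e. e \<in> E \<Longrightarrow> cinner e x = 0" and "x \<noteq> 0"
    define y where "y = (1 / norm x) *\<^sub>R x"
    have "cinner y y = 1" using \<open>x \<noteq> 0\<close> unfolding cinner_self y_def by simp
    moreover have "cinner e y = 0" "cinner y e = 0" if "e \<in> E" for e
      using x[OF that] cinner_eq_zero_commute[of e x] by (simp_all add: y_def cinner_simps)
    ultimately have "orthonormal (insert y E)"
      using E(1) unfolding orthonormal_def by (metis insert_iff)
    hence "y \<in> E" using max[of "insert y E"] E(2) by blast
    thus False using \<open>cinner y y = 1\<close> x \<open>\<And>e. e \<in> E \<Longrightarrow> cinner e y = 0\<close> by force
  qed
  thus ?thesis using that E(2) by blast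
qed

text \<open>Ensures that the choice in \<open>trace_op\<close> really selects a basis.\<close>

lemma is_onb_some: "is_onb (SOME E. is_onb (E :: 'h::complex_hilbert set))"
proof -
  have "orthonormal ({} :: 'h set)" by (simp add: orthonormal_def)
  thus ?thesis using orthonormal_extend_onb by (metis someI_ex)
qed

lemma onb_infinite:
  assumes E: "is_onb (E :: 'h::complex_hilbert set)"
    and infinite_dim: "\<not> (\<exists>B :: 'h set. finite B \<and> cspan B = UNIV)"
  shows "infinite E"
proof
  assume fin: "finite E"
  have "x \<in> cspan E" for x
  proof -
    have "x = (\<Sum>e\<in>E. cinner x e *\<^sub>C e)"
      using fourier_has_sum[OF E, of x] fin by (simp add: has_sum_finite_iff)
    thus ?thesis using fourier_in_cspan[of E x] fin E by (simp add: is_onb_iff)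
  qed
  thus False using fin infinite_dim by blast
qed

section \<open>Nuclear expansions and their traces\<close>

text \<open>\<open>A = \<Sum>\<^sub>k |u\<^sub>k\<rangle>\<langle>v\<^sub>k|\<close>, converging in trace norm.\<close>

definition nuclear_rep ::
    "('h \<Rightarrow> 'h::complex_hilbert) \<Rightarrow> (nat \<Rightarrow> 'h) \<Rightarrow> (nat \<Rightarrow> 'h) \<Rightarrow> bool" where
  "nuclear_rep A u v \<longleftrightarrow>
     summable (\<lambda>k. norm (u k) * norm (v k)) \<and> (\<forall>x. (\<lambda>k. cinner x (v k) *\<^sub>C u k) sums A x)"

lemma nuclear_rep_summable_cinner:
  assumes "nuclear_rep A u v"
  shows "summable (\<lambda>k. cmod (cinner (u k) (v k)))"
proof (rule summable_comparison_test')
  show "summable (\<lambda>k. norm (u k) * norm (v k))" using assms by (simp add: nuclear_rep_def)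
qed (simp add: norm_cinner_le)

text \<open>Summing \<open>h\<close> over \<open>f\<close> first gives
  \<open>cinner (u k) (v k)\<close> by Parseval; summing over \<open>k\<close> first gives the
  diagonal entries of \<open>A\<close>. The value does not mention \<open>F\<close>, so the trace is
  independent of the basis.\<close>

lemma nuclear_rep_trace:
  assumes A: "nuclear_rep A u v" and F: "is_onb F"
  shows "((\<lambda>f. cinner (A f) f) has_sum (\<Sum>k. cinner (u k) (v k))) F"
proof -
  define h where "h = (\<lambda>(k, f). cinner (u k) f * cinner f (v k))"
  have summ: "summable (\<lambda>k. norm (u k) * norm (v k))" using A by (simp add: nuclear_rep_def)
  have row: "((\<lambda>f. h (k, f)) has_sum cinner (u k) (v k)) F" for k
    unfolding h_def using parseval[OF F] by simp
  have col: "((\<lambda>k. h (k, f)) has_sum cinner (A f) f) UNIV" if "f \<in> F" for f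
  proof (rule norm_summable_imp_has_sum)
    have "norm f = 1" using F that orthonormal_norm by (auto simp: is_onb_iff)
    hence "norm (h (k, f)) \<le> norm (u k) * norm (v k)" for k
      unfolding h_def using norm_cinner_le[of "u k" f] norm_cinner_le[of f "v k"]
      by (auto simp: norm_mult intro!: mult_mono)
    thus "summable (\<lambda>k. norm (h (k, f)))"
      by (intro summable_comparison_test'[OF summ, of 0]) auto
    have "(\<lambda>k. cinner f (v k) *\<^sub>C u k) sums A f" using A by (simp add: nuclear_rep_def)
    from bounded_linear.sums[OF bounded_linear_cinner_left this, of f]
    show "(\<lambda>k. h (k, f)) sums cinner (A f) f"
      by (simp add: h_def cinner_scaleC_left mult.commute)
  qed
  \<comment> \<open>Absolute summability licenses the exchange of sums: row \<open>k\<close>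
    contributes at most \<open>norm (u k) * norm (v k)\<close>.\<close>
  have "(\<lambda>z. norm (h z)) summable_on UNIV \<times> F"
    unfolding Infinite_Sum.abs_summable_on_Sigma_iff
  proof (intro conjI ballI)
    show "(\<lambda>f. norm (h (k, f))) summable_on F" for k
      unfolding h_def using parseval_abs_summable(1)[OF F] by simp
    have le: "(\<Sum>\<^sub>\<infinity>f\<in>F. norm (h (k, f))) \<le> norm (u k) * norm (v k)" for k
      unfolding h_def using parseval_abs_summable(2)[OF F] by simp
    have "(\<lambda>k. norm (u k) * norm (v k)) summable_on UNIV"
      using summ by (intro norm_summable_imp_summable_on) simp
    hence "(\<lambda>k. \<Sum>\<^sub>\<infinity>f\<in>F. norm (h (k, f))) summable_on UNIV"
      using le by (rule summable_on_comparison_test) (auto simp: infsum_nonneg)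
    thus "(\<lambda>k. norm (\<Sum>\<^sub>\<infinity>f\<in>F. norm (h (k, f)))) summable_on UNIV"
      by (simp add: infsum_nonneg)
  qed
  then obtain S where S: "(h has_sum S) (UNIV \<times> F)"
    using abs_summable_summable unfolding summable_on_def by blast
  have "((\<lambda>k. cinner (u k) (v k)) has_sum S) UNIV"
    by (rule has_sum_SigmaD[OF S row])
  hence "S = (\<Sum>k. cinner (u k) (v k))" by (simp add: has_sum_imp_sums sums_unique)
  moreover have "((\<lambda>f. cinner (A f) f) has_sum S) F"
  proof (rule has_sum_SigmaD)
    show "((\<lambda>(f, k). h (k, f)) has_sum S) (F \<times> UNIV)" using S has_sum_swap by blast
  qed (use col in simp)
  ultimately show ?thesis by simp
qed

lemma trace_op_nuclear: "nuclear_rep A u v \<Longrightarrow> trace_op A = (\<Sum>k. cinner (u k) (v k))"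
  unfolding trace_op_def by (intro infsumI nuclear_rep_trace is_onb_some)

lemma has_sum_trace_op:
  assumes "nuclear_rep A u v" "is_onb F"
  shows "((\<lambda>f. cinner (A f) f) has_sum trace_op A) F"
  using nuclear_rep_trace[OF assms] trace_op_nuclear[OF assms(1)] by simp

lemma nuclear_rep_compose:
  assumes A: "nuclear_rep A u v" and B: "bounded_op B"
  shows "nuclear_rep (A \<circ> B) u (\<lambda>k. cadjoint B (v k))"
  unfolding nuclear_rep_def
proof (intro conjI allI)
  have "summable (\<lambda>k. onorm B * (norm (u k) * norm (v k)))"
    using A by (intro summable_mult) (simp add: nuclear_rep_def)
  thus "summable (\<lambda>k. norm (u k) * norm (cadjoint B (v k)))"
  proof (rule summable_comparison_test'[of _ 0])
    show "norm (norm (u k) * norm (cadjoint B (v k))) \<le> onorm B * (norm (u k) * norm (v k))" for k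
      using mult_left_mono[OF norm_cadjoint_le[OF B, of "v k"], of "norm (u k)"]
      by (simp add: mult_ac)
  qed
  show "(\<lambda>k. cinner x (cadjoint B (v k)) *\<^sub>C u k) sums (A \<circ> B) x" for x
    using A by (simp add: nuclear_rep_def flip: cinner_cadjoint_right[OF B])
qed

text \<open>The series with the two families exchanged converges by the same norm bound and
  satisfies the adjoint identity term by term.\<close>

lemma nuclear_rep_cadjoint:
  assumes A: "nuclear_rep A u v"
  shows "nuclear_rep (cadjoint A) v u"
proof -
  have summ: "summable (\<lambda>k. norm (u k) * norm (v k))" using A by (simp add: nuclear_rep_def)
  define B where "B y = (\<Sum>k. cinner y (u k) *\<^sub>C v k)" for y
  have B: "(\<lambda>k. cinner y (u k) *\<^sub>C v k) sums B y" for y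
  proof -
    have "norm (cinner y (u k) *\<^sub>C v k) \<le> norm y * (norm (u k) * norm (v k))" for k
      using mult_right_mono[OF norm_cinner_le[of y "u k"], of "norm (v k)"] by (simp add: mult_ac)
    hence "summable (\<lambda>k. cinner y (u k) *\<^sub>C v k)"
      by (intro summable_comparison_test'[OF summable_mult[OF summ], of 0]) auto
    thus ?thesis unfolding B_def by (rule summable_sums)
  qed
  have "cadjoint A = B"
  proof (rule cadjoint_unique)
    fix x y
    have "(\<lambda>k. cinner x (v k) *\<^sub>C u k) sums A x" using A by (simp add: nuclear_rep_def)
    from bounded_linear.sums[OF bounded_linear_cinner_left this, of y]
    have 1: "(\<lambda>k. cinner x (v k) * cinner (u k) y) sums cinner (A x) y"
      by (simp add: cinner_scaleC_left)
    from bounded_linear.sums[OF bounded_linear_cinner_right B, of x y]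
    have "(\<lambda>k. cinner x (v k) * cinner (u k) y) sums cinner x (B y)"
      by (simp add: cinner_scaleC_right mult.commute flip: cinner_commute)
    thus "cinner (A x) y = cinner x (B y)" using 1 sums_unique2 by blast
  qed
  thus ?thesis using summ B by (simp add: nuclear_rep_def mult.commute)
qed

text \<open>The adjoint of \<open>A \<circ> B\<close> has its factors in the opposite order, so this
  contains an instance of cyclicity of the trace. The expansions give it termwise: both sides reduce
  to \<open>cinner (v k) (B (u k))\<close>.\<close>

lemma trace_compose_cadjoint:
  assumes A: "nuclear_rep A u v" and B: "bounded_op B"
  shows "trace_op (cadjoint A \<circ> cadjoint B) = cnj (trace_op (A \<circ> B))"
proof -
  have cc: "cadjoint (cadjoint B) = B"
    by (rule cadjoint_unique) (rule cinner_cadjoint_left[OF B])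
  have eq: "cinner (v k) (B (u k)) = cnj (cinner (u k) (cadjoint B (v k)))" for k
    using cinner_commute[of "v k" "B (u k)"] by (simp only: cinner_cadjoint_right[OF B])
  have "trace_op (cadjoint A \<circ> cadjoint B) = (\<Sum>k. cinner (v k) (B (u k)))"
    using trace_op_nuclear[OF nuclear_rep_compose[OF nuclear_rep_cadjoint[OF A]
        bounded_op_cadjoint[OF B]]] cc by simp
  also have "\<dots> = cnj (\<Sum>k. cinner (u k) (cadjoint B (v k)))"
    unfolding eq
    using bounded_linear.suminf[OF bounded_linear_cnj summable_norm_cancel[OF
          nuclear_rep_summable_cinner[OF nuclear_rep_compose[OF A B]]]] by simp
  finally show ?thesis using trace_op_nuclear[OF nuclear_rep_compose[OF A B]] by simp
qed

section \<open>Expansions of trace-class operators\<close>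

lemma positive_opD:
  assumes "positive_op P"
  shows "bounded_op P" "0 \<le> Re (cinner (P x) x)" "cinner (P x) x = of_real (Re (cinner (P x) x))"
  using assms by (auto simp: positive_op_def of_real_Re)

text \<open>Polarisation: reality of the quadratic form at \<open>x + y\<close> and at
  \<open>x + \<i> *\<^sub>C y\<close> fixes the imaginary and the real part.\<close>

lemma positive_op_hermitian:
  assumes P: "positive_op P"
  shows "cinner (P x) y = cinner x (P y)"
proof -
  note simps = bounded_op_simps[OF positive_opD(1)[OF P]] cinner_simps
  have Im: "Im (cinner (P z) z) = 0" for z
    using positive_opD(3)[OF P, of z] by (metis Im_complex_of_real)
  have "Im (cinner (P x) y) + Im (cinner (P y) x) = 0"
    using Im[of "x + y"] Im[of x] Im[of y] by (simp add: simps)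
  moreover have "Re (cinner (P x) y) = Re (cinner (P y) x)"
    using Im[of "x + \<i> *\<^sub>C y"] Im[of x] Im[of y] by (simp add: simps)
  ultimately have "cinner (P y) x = cnj (cinner (P x) y)" by (simp add: complex_eq_iff)
  thus ?thesis using cinner_commute[of "P y" x] by simp
qed

text \<open>With \<open>a = cinner (P x) y\<close>, the form is nonnegative at \<open>x\<close>
  minus \<open>t * a\<close> times \<open>y\<close>; it remains to choose the real number
  \<open>t\<close> well.\<close>

lemma positive_op_cauchy_schwarz:
  assumes P: "positive_op P"
  shows "(cmod (cinner (P x) y))\<^sup>2 \<le> Re (cinner (P x) x) * Re (cinner (P y) y)"
proof -
  note simps = bounded_op_simps[OF positive_opD(1)[OF P]] cinner_simps
  define a where "a = cinner (P x) y"
  define q where "q z = Re (cinner (P z) z)" for z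
  have q: "cinner (P z) z = of_real (q z)" for z unfolding q_def by (rule positive_opD(3)[OF P])
  have yx: "cinner (P y) x = cnj a"
    unfolding a_def positive_op_hermitian[OF P, of y x] by (rule cinner_commute)
  have quad: "0 \<le> q x - 2 * t * (cmod a)\<^sup>2 + t\<^sup>2 * (cmod a)\<^sup>2 * q y" for t
  proof -
    define c where "c = of_real t * a"
    have "of_real (q (x - c *\<^sub>C y)) = of_real (q x) - cnj c * a - c * cnj a + c * cnj c * of_real (q y)"
      by (simp add: q[symmetric] simps a_def[symmetric] yx algebra_simps)
    also have "\<dots> = of_real (q x) - 2 * of_real t * (a * cnj a) + (of_real t)\<^sup>2 * (a * cnj a) * of_real (q y)"
      by (simp add: c_def algebra_simps power2_eq_square)
    also have "\<dots> = complex_of_real (q x - 2 * t * (cmod a)\<^sup>2 + t\<^sup>2 * (cmod a)\<^sup>2 * q y)"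
      unfolding complex_norm_square[symmetric] by simp
    finally have "q (x - c *\<^sub>C y) = q x - 2 * t * (cmod a)\<^sup>2 + t\<^sup>2 * (cmod a)\<^sup>2 * q y"
      by (simp only: of_real_eq_iff)
    thus ?thesis using positive_opD(2)[OF P, of "x - c *\<^sub>C y"] by (simp add: q_def)
  qed
  have "(cmod a)\<^sup>2 \<le> q x * q y"
  proof (cases "q y = 0")
    case True
    \<comment> \<open>For \<open>q y = 0\<close> the bound \<open>quad\<close> is affine in
      \<open>t\<close> and fails for large \<open>t\<close> unless \<open>a = 0\<close>.\<close>
    have "a = 0"
    proof (rule ccontr)
      assume "a \<noteq> 0"
      thus False using quad[of "(q x + 1) / (2 * (cmod a)\<^sup>2)"] True by (simp add: field_simps)
    qed
    thus ?thesis using True by simp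
  next
    case False
    hence "q y > 0" using positive_opD(2)[OF P, of y] by (simp add: q_def)
    thus ?thesis using quad[of "1 / q y"] by (simp add: field_simps power2_eq_square)
  qed
  thus ?thesis by (simp add: a_def q_def)
qed

text \<open>Cauchy-Schwarz with \<open>y = P x\<close>, then cancellation. The form bound
  \<open>M\<close> is a parameter so that one constant serves all Cholesky residuals.\<close>

lemma positive_op_norm_le:
  assumes P: "positive_op P" and M: "\<And>y. Re (cinner (P y) y) \<le> M * (norm y)\<^sup>2"
  shows "(norm (P x))\<^sup>2 \<le> M * Re (cinner (P x) x)"
proof (cases "P x = 0")
  case False
  have "(norm (P x))\<^sup>2 * (norm (P x))\<^sup>2 = (cmod (cinner (P x) (P x)))\<^sup>2"
    unfolding cinner_self norm_of_real by (simp add: power2_eq_square)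
  also have "\<dots> \<le> Re (cinner (P x) x) * Re (cinner (P (P x)) (P x))"
    by (rule positive_op_cauchy_schwarz[OF P])
  also have "\<dots> \<le> Re (cinner (P x) x) * (M * (norm (P x))\<^sup>2)"
    by (intro mult_left_mono M positive_opD(2)[OF P])
  finally have "(norm (P x))\<^sup>2 * (norm (P x))\<^sup>2 \<le> (M * Re (cinner (P x) x)) * (norm (P x))\<^sup>2"
    by (simp add: mult_ac)
  thus ?thesis using False by (simp only: mult_le_cancel_right) simp
next
  case True thus ?thesis by (simp add: cinner_simps)
qed

lemma positive_op_bound:
  assumes P: "positive_op P"
  shows "Re (cinner (P y) y) \<le> onorm P * (norm y)\<^sup>2"
proof -
  have "Re (cinner (P y) y) \<le> norm (P y) * norm y"
    using norm_cinner_le complex_Re_le_cmod order_trans by blast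
  also have "\<dots> \<le> (onorm P * norm y) * norm y"
    by (intro mult_right_mono onorm bounded_opD(1) positive_opD(1) P norm_ge_zero)
  finally show ?thesis by (simp add: power2_eq_square mult_ac)
qed

lemma positive_op_eq_zero:
  assumes "positive_op P" "Re (cinner (P x) x) \<le> 0"
  shows "P x = 0"
proof -
  have "(norm (P x))\<^sup>2 \<le> onorm P * Re (cinner (P x) x)"
    by (intro positive_op_norm_le positive_op_bound assms(1))
  also have "\<dots> \<le> 0"
    using assms(2) onorm_pos_le[OF bounded_opD(1)[OF positive_opD(1)[OF assms(1)]]]
    by (simp add: mult_nonneg_nonpos)
  finally show ?thesis by simp
qed

section \<open>Cholesky elimination\<close>

text \<open>The division by zero is harmless: if the pivot vanishes then so does \<open>R g\<close>.\<close>

lemma cholesky_step: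
  assumes R: "positive_op R" and v: "v = (1 / sqrt (Re (cinner (R g) g))) *\<^sub>R R g"
  shows "cinner (R x - cinner x v *\<^sub>C v) x = cinner (R x) x - (cmod (cinner x v))\<^sup>2"
    and "positive_op (\<lambda>x. R x - cinner x v *\<^sub>C v)"
    and "R g - cinner g v *\<^sub>C v = 0"
proof -
  define c where "c = Re (cinner (R g) g)"
  have c: "c \<ge> 0" unfolding c_def by (rule positive_opD(2)[OF R])
  have v: "v = (1 / sqrt c) *\<^sub>R R g" by (simp add: v c_def)
  have cv: "cinner x v = of_real (1 / sqrt c) * cinner (R x) g" for x
    unfolding v cinner_scaleR_right positive_op_hermitian[OF R] ..
  show eq: "cinner (R x - cinner x v *\<^sub>C v) x = cinner (R x) x - (cmod (cinner x v))\<^sup>2" for x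
    using cinner_commute[of v x] by (simp add: cinner_simps flip: complex_norm_square)
  \<comment> \<open>Cauchy-Schwarz against the pivot: the subtracted square never exceeds the form,
    so the residual stays positive.\<close>
  have le: "(cmod (cinner x v))\<^sup>2 \<le> Re (cinner (R x) x)" for x
  proof (cases "c = 0")
    case True
    thus ?thesis using positive_opD(2)[OF R] by (simp add: v cinner_simps)
  next
    case False
    have "(cmod (cinner x v))\<^sup>2 = (cmod (cinner (R x) g))\<^sup>2 / c"
      using c unfolding cv norm_mult norm_of_real by (simp add: power_divide)
    also have "\<dots> \<le> Re (cinner (R x) x)"
      using positive_op_cauchy_schwarz[OF R, of x g] False c by (simp add: divide_simps c_def)
    finally show ?thesis .
  qed
  show "positive_op (\<lambda>x. R x - cinner x v *\<^sub>C v)"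
    unfolding positive_op_def eq
  proof (intro conjI allI bounded_op_diff bounded_op_rank_one positive_opD(1)[OF R])
    show "cinner (R x) x - complex_of_real ((cmod (cinner x v))\<^sup>2) \<in> \<real>" for x
      by (subst positive_opD(3)[OF R]) (intro Reals_diff Reals_of_real)
  qed (use le in simp)
  show "R g - cinner g v *\<^sub>C v = 0"
  proof (cases "c = 0")
    case True
    thus ?thesis using positive_op_eq_zero[OF R, of g] by (simp add: v c_def cinner_simps)
  next
    case False
    have "cinner g v = of_real (1 / sqrt c) * of_real c"
      unfolding cv c_def positive_opD(3)[OF R, symmetric] ..
    also have "\<dots> = of_real (sqrt c)"
      using False c by (simp only: of_real_mult[symmetric]) (simp add: real_div_sqrt)
    finally show ?thesis using False c by (simp add: v scaleC_of_real)
  qed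
qed

text \<open>\<open>Q (cholesky Q g k x)\<close> is the residual of \<open>Q x\<close> after \<open>k\<close> elimination steps with pivots
  \<open>g 0, \<dots>, g (k-1)\<close>. Keeping the vectors before \<open>Q\<close> is applied lets the decomposition of \<open>|A|\<close> be
  transported to \<open>A\<close>, without a polar decomposition.\<close>

primrec cholesky ::
    "('h \<Rightarrow> 'h::complex_hilbert) \<Rightarrow> (nat \<Rightarrow> 'h) \<Rightarrow> nat \<Rightarrow> 'h \<Rightarrow> 'h" where
  "cholesky Q g 0 = (\<lambda>x. x)"
| "cholesky Q g (Suc k) = (\<lambda>x. cholesky Q g k x -
     (let w = (1 / sqrt (Re (cinner (Q (cholesky Q g k (g k))) (g k)))) *\<^sub>R cholesky Q g k (g k)
      in cinner x (Q w) *\<^sub>C w))"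

lemma has_sum_sum:
  fixes f :: "'i \<Rightarrow> 'a \<Rightarrow> 'b::topological_comm_monoid_add"
  assumes "\<And>k. k \<in> I \<Longrightarrow> (f k has_sum s k) A"
  shows "((\<lambda>x. \<Sum>k\<in>I. f k x) has_sum (\<Sum>k\<in>I. s k)) A"
  using assms by (induction I rule: infinite_finite_induct) (auto intro!: has_sum_add has_sum_0)

text \<open>The residuals \<open>R n\<close> are positive, decrease in \<open>n\<close>, and vanish
  on each basis vector from some point on. With a uniform norm bound they tend to zero on every
  vector.\<close>

lemma positive_op_cholesky:
  assumes Q: "positive_op Q" and E: "is_onb E" and summ: "(\<lambda>e. cinner (Q e) e) summable_on E"
  obtains w where "summable (\<lambda>k. (norm (Q (w k)))\<^sup>2)"
    and "\<And>x. (\<lambda>n. Q (x - (\<Sum>k<n. cinner x (Q (w k)) *\<^sub>C w k))) \<longlonglongrightarrow> 0"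
proof -
  have Qb: "bounded_op Q" by (rule positive_opD(1)[OF Q])
  \<comment> \<open>Summability leaves countably many nonzero diagonal entries to serve as pivots;
    \<open>Q\<close> kills the other basis vectors.\<close>
  define E' where "E' = {e \<in> E. cinner (Q e) e \<noteq> 0}"
  have "countable E'"
    unfolding E'_def using summable_countable_complex[OF summ] by simp
  \<comment> \<open>Inserting 0 keeps the enumerated set nonempty. A zero or repeated pivot gives
    \<open>w k = 0\<close> and changes nothing.\<close>
  define g where "g = from_nat_into (insert 0 E')"
  have range_g: "range g = insert 0 E'"
    unfolding g_def using \<open>countable E'\<close> by (intro range_from_nat_into) auto
  define T where "T = cholesky Q g"
  define w where "w k = (1 / sqrt (Re (cinner (Q (T k (g k))) (g k)))) *\<^sub>R T k (g k)" for k
  define v where "v k = Q (w k)" for k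
  define R where "R k x = Q (T k x)" for k x
  have T_Suc: "T (Suc k) x = T k x - cinner x (v k) *\<^sub>C w k" for k x
    by (simp add: T_def w_def v_def Let_def)
  have T_eq: "T n x = x - (\<Sum>k<n. cinner x (v k) *\<^sub>C w k)" for n x
    by (induction n) (simp_all only: T_Suc, simp_all add: T_def)
  have R_Suc: "R (Suc k) = (\<lambda>x. R k x - cinner x (v k) *\<^sub>C v k)" for k
    by (simp add: R_def T_Suc v_def bounded_op_simps[OF Qb] fun_eq_iff)
  have v_eq: "v k = (1 / sqrt (Re (cinner (R k (g k)) (g k)))) *\<^sub>R R k (g k)" for k
    by (simp only: v_def w_def R_def bounded_op_simps[OF Qb])
  have R_pos: "positive_op (R k)" for k
  proof (induction k)
    case 0
    thus ?case using Q by (simp add: R_def T_def)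
  next
    case (Suc k)
    thus ?case unfolding R_Suc by (rule cholesky_step(2)) (rule v_eq)
  qed
  have R_step: "Re (cinner (R (Suc k) x) x) = Re (cinner (R k x) x) - (cmod (cinner x (v k)))\<^sup>2" for k x
    unfolding R_Suc cholesky_step(1)[OF R_pos v_eq] by simp
  have R_form: "Re (cinner (R n x) x) = Re (cinner (Q x) x) - (\<Sum>k<n. (cmod (cinner x (v k)))\<^sup>2)" for n x
    by (induction n) (simp_all add: R_step, simp add: R_def T_def)
  have R_antimono: "Re (cinner (R n x) x) \<le> Re (cinner (R m x) x)" if "m \<le> n" for m n x
    unfolding R_form using that by (auto intro!: sum_mono2)
  have R_zero: "R n x = 0" if "R m x = 0" "m \<le> n" for m n x
    using R_antimono[OF that(2), of x] that(1)
    by (intro positive_op_eq_zero[OF R_pos]) (simp add: cinner_simps)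
  define M where "M = onorm Q"
  have M: "Re (cinner (R n y) y) \<le> M * (norm y)\<^sup>2" for n y
    using positive_op_bound[OF Q, of y] R_antimono[of 0 n y] by (simp add: R_def T_def M_def)
  have M0: "M \<ge> 0" unfolding M_def by (intro onorm_pos_le bounded_opD(1)[OF Qb])
  have R_norm: "norm (R n x) \<le> M * norm x" for n x
  proof (rule power2_le_imp_le)
    have "(norm (R n x))\<^sup>2 \<le> M * Re (cinner (R n x) x)"
      by (intro positive_op_norm_le R_pos M)
    also have "\<dots> \<le> M * (M * (norm x)\<^sup>2)" by (intro mult_left_mono M M0)
    finally show "(norm (R n x))\<^sup>2 \<le> (M * norm x)\<^sup>2" by (simp add: power2_eq_square mult_ac)
  qed (simp add: M0)
  have lim_E: "(\<lambda>n. R n e) \<longlonglongrightarrow> 0" if "e \<in> E" for e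
  proof -
    obtain m where "R m e = 0"
    proof (cases "e \<in> E'")
      case True
      then obtain j where "g j = e" using range_g by (metis insertI2 rangeE)
      \<comment> \<open>The pivot of step \<open>j\<close> is annihilated by the residual with index
        \<open>Suc j\<close>, hence by all later ones.\<close>
      hence "R (Suc j) e = 0" using cholesky_step(3)[OF R_pos v_eq, of j] by (simp add: R_Suc)
      thus ?thesis by (rule that)
    next
      case False
      hence "Q e = 0" using \<open>e \<in> E\<close> by (intro positive_op_eq_zero[OF Q]) (simp add: E'_def)
      thus ?thesis using that[of 0] by (simp add: R_def T_def)
    qed
    hence "\<And>n. n \<ge> m \<Longrightarrow> R n e = 0" using R_zero by blast
    thus ?thesis by (intro tendsto_eventually) (auto simp: eventually_sequentially)
  qed
  have lim_span: "(\<lambda>n. R n y) \<longlonglongrightarrow> 0" if "y \<in> cspan E" for y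
    using that
  proof (induction rule: cvs.span_induct_alt)
    case (step c x y)
    have "(\<lambda>n. c *\<^sub>C R n x + R n y) \<longlonglongrightarrow> c *\<^sub>C 0 + 0"
      by (intro tendsto_add step bounded_linear.tendsto[OF bounded_linear_scaleC] lim_E)
    thus ?case by (simp add: bounded_op_simps[OF positive_opD(1)[OF R_pos]])
  qed (simp add: bounded_op_simps[OF positive_opD(1)[OF R_pos]])
  have lim: "(\<lambda>n. R n x) \<longlonglongrightarrow> 0" for x
  proof (rule LIMSEQ_I)
    fix \<epsilon> :: real assume "\<epsilon> > 0"
    \<comment> \<open>Density argument with the uniform bound \<open>R_norm\<close>; the
      \<open>+ 1\<close> covers \<open>M = 0\<close>.\<close>
    define \<delta> where "\<delta> = \<epsilon> / (2 * (M + 1))"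
    have \<delta>: "\<delta> > 0" using \<open>\<epsilon> > 0\<close> M0 by (simp add: \<delta>_def)
    have "x \<in> closure (cspan E)" using E by (simp add: is_onb_iff)
    then obtain y where y: "y \<in> cspan E" "dist y x < \<delta>"
      using \<delta> unfolding closure_approachable by blast
    obtain N where N: "\<And>n. n \<ge> N \<Longrightarrow> norm (R n y) < \<epsilon> / 2"
      using LIMSEQ_D[OF lim_span[OF y(1)], of "\<epsilon> / 2"] \<open>\<epsilon> > 0\<close> by auto
    have "norm (R n x) < \<epsilon>" if "n \<ge> N" for n
    proof -
      have "norm (R n x) \<le> norm (R n (x - y)) + norm (R n y)"
        using norm_triangle_ineq[of "R n (x - y)" "R n y"]
        by (simp add: bounded_op_simps[OF positive_opD(1)[OF R_pos]])
      also have "norm (R n (x - y)) \<le> M * \<delta>"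
        using R_norm[of n "x - y"] mult_left_mono[OF less_imp_le[OF y(2)] M0]
        by (simp add: dist_norm norm_minus_commute)
      also have "M * \<delta> \<le> \<epsilon> / 2"
        using M0 \<open>\<epsilon> > 0\<close> by (simp add: \<delta>_def field_simps)
      finally show ?thesis using N[OF that] by simp
    qed
    thus "\<exists>N. \<forall>n\<ge>N. norm (R n x - 0) < \<epsilon>" by auto
  qed
  obtain C where C: "((\<lambda>e. Re (cinner (Q e) e)) has_sum C) E"
    using summ has_sum_bounded_linear[OF bounded_linear_Re] unfolding summable_on_def by blast
  \<comment> \<open>Parseval expands each squared norm over \<open>E\<close>. For fixed
    \<open>e\<close>, nonnegativity of the residual form bounds the sum over \<open>k\<close> by the
    diagonal entry of \<open>Q\<close>, so the total is at most the trace \<open>C\<close>.\<close>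
  have "(\<Sum>k<n. (norm (v k))\<^sup>2) \<le> C" for n
  proof (rule has_sum_mono[OF has_sum_sum C])
    show "((\<lambda>e. (cmod (cinner e (v k)))\<^sup>2) has_sum (norm (v k))\<^sup>2) E" for k
    proof -
      have "cinner (v k) e * cinner e (v k) = of_real ((cmod (cinner e (v k)))\<^sup>2)" for e
        using cinner_commute[of e "v k"] by (simp add: mult.commute flip: complex_norm_square)
      thus ?thesis
        using has_sum_bounded_linear[OF bounded_linear_Re parseval[OF E, of "v k" "v k"]]
        by (simp add: cinner_self)
    qed
    show "(\<Sum>k<n. (cmod (cinner e (v k)))\<^sup>2) \<le> Re (cinner (Q e) e)" for e
      using positive_opD(2)[OF R_pos[of n], of e] by (simp add: R_form)
  qed
  hence "(\<Sum>k\<le>n. (norm (v k))\<^sup>2) \<le> C" for n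
    by (simp only: lessThan_Suc_atMost[symmetric])
  hence "summable (\<lambda>k. (norm (v k))\<^sup>2)"
    by (intro bounded_imp_summable[of _ C]) auto
  moreover have "(\<lambda>n. Q (x - (\<Sum>k<n. cinner x (v k) *\<^sub>C w k))) \<longlonglongrightarrow> 0" for x
    using lim[of x] by (simp add: R_def T_eq)
  ultimately show ?thesis using that by (simp add: v_def)
qed

section \<open>Expansions obtained from the elimination\<close>

lemma sums_if_residual_tendsto_0:
  assumes A: "bounded_op A"
    and lim: "(\<lambda>n. A (x - (\<Sum>k<n. a k *\<^sub>C w k))) \<longlonglongrightarrow> 0"
  shows "(\<lambda>k. a k *\<^sub>C A (w k)) sums A x"
proof -
  have "(\<lambda>n. A x - (\<Sum>k<n. a k *\<^sub>C A (w k))) \<longlonglongrightarrow> 0"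
    using lim by (simp add: bounded_op_simps[OF A])
  from tendsto_diff[OF tendsto_const[of "A x"] this]
  show ?thesis by (simp add: sums_def)
qed

lemma positive_op_nuclear:
  assumes P: "positive_op P" and E: "is_onb E" and summ: "(\<lambda>e. cinner (P e) e) summable_on E"
  obtains p where "nuclear_rep P p p"
proof -
  obtain w where w: "summable (\<lambda>k. (norm (P (w k)))\<^sup>2)"
    "\<And>x. (\<lambda>n. P (x - (\<Sum>k<n. cinner x (P (w k)) *\<^sub>C w k))) \<longlonglongrightarrow> 0"
    using positive_op_cholesky[OF assms] by blast
  have "nuclear_rep P (\<lambda>k. P (w k)) (\<lambda>k. P (w k))"
    unfolding nuclear_rep_def using w(1) sums_if_residual_tendsto_0[OF positive_opD(1)[OF P] w(2)]
    by (simp add: power2_eq_square)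
  thus ?thesis by (rule that)
qed

lemma is_abs_op_norm:
  assumes "is_abs_op P A" and A: "bounded_op A"
  shows "norm (A x) = norm (P x)"
proof -
  have P: "positive_op P" and eq: "P (P x) = cadjoint A (A x)"
    using assms(1) by (auto simp: is_abs_op_def fun_eq_iff)
  have "cinner (A x) (A x) = cinner (P x) (P x)"
    by (simp add: cinner_cadjoint_right[OF A] positive_op_hermitian[OF P] eq)
  hence "(norm (A x))\<^sup>2 = (norm (P x))\<^sup>2" by (simp only: cinner_self of_real_eq_iff)
  thus ?thesis by simp
qed

text \<open>The elimination runs on \<open>Q\<close>, the absolute value of \<open>A\<close>. By
  \<open>is_abs_op_norm\<close> the residual vectors tend to zero under \<open>A\<close> as well,
  and \<open>A (w k)\<close> has the norm of \<open>Q (w k)\<close>.\<close>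

lemma trace_class_nuclear:
  assumes "trace_class A"
  obtains u v where "nuclear_rep A u v"
proof -
  obtain Q E where A: "bounded_op A" and QA: "is_abs_op Q A" and E: "is_onb E"
    and summ: "(\<lambda>e. cinner (Q e) e) summable_on E"
    using assms by (auto simp: trace_class_def)
  have Q: "positive_op Q" using QA by (simp add: is_abs_op_def)
  obtain w where w: "summable (\<lambda>k. (norm (Q (w k)))\<^sup>2)"
    "\<And>x. (\<lambda>n. Q (x - (\<Sum>k<n. cinner x (Q (w k)) *\<^sub>C w k))) \<longlonglongrightarrow> 0"
    using positive_op_cholesky[OF Q E summ] by blast
  note norm_eq = is_abs_op_norm[OF QA A]
  have "(\<lambda>n. A (x - (\<Sum>k<n. cinner x (Q (w k)) *\<^sub>C w k))) \<longlonglongrightarrow> 0" for x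
    using w(2)[of x] by (subst (asm) tendsto_norm_zero_iff[symmetric]) (simp add: tendsto_norm_zero_iff flip: norm_eq)
  hence "nuclear_rep A (\<lambda>k. A (w k)) (\<lambda>k. Q (w k))"
    unfolding nuclear_rep_def using w(1) sums_if_residual_tendsto_0[OF A]
    by (simp add: power2_eq_square norm_eq)
  thus ?thesis by (rule that)
qed

section \<open>The Bohr inequality\<close>

lemma cinner_mult_cinner_commuted: "cinner x y * cinner y x = of_real ((cmod (cinner x y))\<^sup>2)"
  unfolding complex_norm_square by (subst cinner_commute[of y x]) simp

text \<open>Termwise Cauchy-Schwarz: \<open>cadjoint B\<close> is a contraction, and the squared
  norms of the \<open>p k\<close> add up to the trace of \<open>P\<close>.\<close>

lemma trace_positive_compose_le:
  assumes P: "nuclear_rep P p p" and B: "bounded_op B" "onorm B \<le> 1"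
  shows "cmod (trace_op (P \<circ> B)) \<le> Re (trace_op P)"
proof -
  have summ: "summable (\<lambda>k. norm (p k) * norm (p k))" using P by (simp add: nuclear_rep_def)
  have le: "cmod (cinner (p k) (cadjoint B (p k))) \<le> norm (p k) * norm (p k)" for k
  proof -
    have "norm (cadjoint B (p k)) \<le> 1 * norm (p k)"
      using norm_cadjoint_le[OF B(1)] mult_right_mono[OF B(2) norm_ge_zero] order_trans by blast
    hence "norm (p k) * norm (cadjoint B (p k)) \<le> norm (p k) * norm (p k)"
      by (intro mult_left_mono) auto
    thus ?thesis using norm_cinner_le order_trans by blast
  qed
  have "cmod (trace_op (P \<circ> B)) \<le> (\<Sum>k. norm (p k) * norm (p k))"
    unfolding trace_op_nuclear[OF nuclear_rep_compose[OF P B(1)]]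
    using summable_norm[OF nuclear_rep_summable_cinner[OF nuclear_rep_compose[OF P B(1)]]]
      suminf_le[OF le nuclear_rep_summable_cinner[OF nuclear_rep_compose[OF P B(1)]] summ]
    by (rule order_trans)
  moreover have "trace_op P = of_real (\<Sum>k. norm (p k) * norm (p k))"
    unfolding trace_op_nuclear[OF P] suminf_of_real[OF summ]
    by (simp only: cinner_self power2_eq_square)
  ultimately show ?thesis by simp
qed

lemma trace_compose_cadjoint_le:
  assumes A: "trace_class A" and S: "trace_class S" "selfadjoint_op S"
    and le: "op_le (re_op A) S" and real: "trace_op A \<in> \<real>"
    and B: "bounded_op B" "onorm B \<le> 1"
    and SB: "trace_op (S \<circ> B) = 0" and AB: "trace_op (A \<circ> B) = 0"
  shows "cmod (trace_op (A \<circ> cadjoint B)) \<le> 2 * (Re (trace_op S) - Re (trace_op A))"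
proof -
  \<comment> \<open>Fixing one basis lets traces be added as sums of diagonal entries.\<close>
  define F where "F = (SOME E. is_onb (E :: 'a set))"
  have F: "is_onb F" unfolding F_def by (rule is_onb_some)
  obtain u v where uv: "nuclear_rep A u v" using A by (rule trace_class_nuclear)
  obtain s t where st: "nuclear_rep S s t" using S(1) by (rule trace_class_nuclear)
  have S_adj: "cadjoint S = S" using S(2) by (simp add: selfadjoint_op_def)
  have B': "bounded_op (cadjoint B)" by (rule bounded_op_cadjoint[OF B(1)])
  define P where "P x = S x - re_op A x" for x
  have P: "positive_op P" using le by (simp add: op_le_def P_def[abs_def])
  have P_form: "cinner (P x) y = cinner (S x) y + (- (1/2)) * (cinner (A x) y + cinner (cadjoint A x) y)" for x y
    by (simp add: P_def re_op_def cinner_simps)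
  \<comment> \<open>The case of \<open>trace_compose_cadjoint\<close> where \<open>B\<close> is the
    identity.\<close>
  have "trace_op (cadjoint A) = cnj (trace_op A)"
  proof -
    have id: "bounded_op (\<lambda>x::'a. x)" by (simp add: bounded_op_def bounded_linear_ident)
    moreover have "cadjoint (\<lambda>x::'a. x) = (\<lambda>x. x)" by (rule cadjoint_unique) simp
    ultimately show ?thesis using trace_compose_cadjoint[OF uv id] by (simp add: o_def)
  qed
  also have "\<dots> = trace_op A" using real by (simp add: Reals_cnj_iff)
  finally have A_adj: "trace_op (cadjoint A) = trace_op A" .
  have "((\<lambda>f. cinner (P f) f) has_sum
      (trace_op S + (- (1/2)) * (trace_op A + trace_op (cadjoint A)))) F"
    unfolding P_form
    by (intro has_sum_add has_sum_cmult_right has_sum_trace_op[OF st F]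
        has_sum_trace_op[OF uv F] has_sum_trace_op[OF nuclear_rep_cadjoint[OF uv] F])
  hence P_sum: "((\<lambda>f. cinner (P f) f) has_sum (trace_op S - trace_op A)) F"
    by (simp add: A_adj)
  \<comment> \<open>\<open>positive_op_nuclear\<close> needs the diagonal of \<open>P\<close> to be
    summable, which \<open>P_sum\<close> has just shown.\<close>
  then obtain p where p: "nuclear_rep P p p"
    using positive_op_nuclear[OF P F] unfolding summable_on_def by blast
  have trP: "trace_op P = trace_op S - trace_op A"
    using has_sum_unique[OF has_sum_trace_op[OF p F] P_sum] .
  have "((\<lambda>f. cinner ((P \<circ> cadjoint B) f) f) has_sum
      (trace_op (S \<circ> cadjoint B) +
        (- (1/2)) * (trace_op (A \<circ> cadjoint B) + trace_op (cadjoint A \<circ> cadjoint B)))) F"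
    unfolding o_apply P_form
    using has_sum_trace_op[OF nuclear_rep_compose[OF st B'] F]
      has_sum_trace_op[OF nuclear_rep_compose[OF uv B'] F]
      has_sum_trace_op[OF nuclear_rep_compose[OF nuclear_rep_cadjoint[OF uv] B'] F]
    by (intro has_sum_add has_sum_cmult_right) (simp_all add: o_def)
  \<comment> \<open>The vanishing traces are given for \<open>B\<close>; conjugation transfers them
    to \<open>cadjoint B\<close>.\<close>
  moreover have "trace_op (cadjoint A \<circ> cadjoint B) = 0"
    using trace_compose_cadjoint[OF uv B(1)] AB by simp
  moreover have "trace_op (S \<circ> cadjoint B) = 0"
    using trace_compose_cadjoint[OF st B(1)] SB by (simp add: S_adj)
  ultimately have "((\<lambda>f. cinner ((P \<circ> cadjoint B) f) f) has_sum
      (- (1/2) * trace_op (A \<circ> cadjoint B))) F"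
    by simp
  hence "trace_op (P \<circ> cadjoint B) = - (1/2) * trace_op (A \<circ> cadjoint B)"
    using has_sum_unique[OF has_sum_trace_op[OF nuclear_rep_compose[OF p B'] F]] by blast
  moreover have "cmod (trace_op (P \<circ> cadjoint B)) \<le> Re (trace_op P)"
    using onorm_cadjoint_le[OF B(1)] B(2) by (intro trace_positive_compose_le[OF p B']) simp
  ultimately show ?thesis by (simp add: trP norm_mult)
qed

lemma bohr_ineq_third:
  assumes hyps: "bohr_hyps A S An" and r: "0 \<le> r" "r \<le> 1/3"
  shows "bohr_ineq A S An r"
proof -
  define a where "a = Re (trace_op A)"
  define d where "d = Re (trace_op S) - a"
  define c where "c n = cmod (bohr_coeff A An n) * r ^ n" for n
  have c0: "c 0 = a"
  proof -
    have "trace_op A = of_real a" unfolding a_def using hyps by (simp add: bohr_hyps_def of_real_Re)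
    moreover have "a \<ge> 0" unfolding a_def using hyps by (simp add: bohr_hyps_def)
    ultimately show ?thesis by (simp add: c_def bohr_coeff_def)
  qed
  have coeff: "cmod (bohr_coeff A An (Suc n)) \<le> 2 * d" for n
    using trace_compose_cadjoint_le[of A S "An (Suc n)"] hyps
    by (simp add: d_def a_def bohr_coeff_def bohr_hyps_def)
  \<comment> \<open>The coefficient bound itself gives this, since a modulus is at most
    \<open>2 * d\<close>.\<close>
  hence "d \<ge> 0" using norm_ge_zero order_trans by (metis mult_2 add_le_same_cancel1 zero_le_double_add_iff_zero_le_single_add)
  have c_le: "c (Suc n) \<le> 2 * d * r * r ^ n" for n
    using mult_right_mono[OF coeff[of n], of "r ^ Suc n"] r by (simp add: c_def mult_ac)
  have c_nonneg: "c n \<ge> 0" for n using r by (simp add: c_def)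
  have geo: "(\<lambda>n. 2 * d * r * r ^ n) sums (2 * d * r * (1 / (1 - r)))"
    using r by (intro sums_mult geometric_sums) simp
  have summ: "summable (\<lambda>n. c (Suc n))"
    using c_le c_nonneg by (intro summable_comparison_test'[OF sums_summable[OF geo], of 0]) auto
  have "(\<Sum>n. c (Suc n)) \<le> 2 * d * r * (1 / (1 - r))"
    using suminf_le[OF c_le summ sums_summable[OF geo]] sums_unique[OF geo] by simp
  \<comment> \<open>Here the constant 1/3 enters, as \<open>2 * r \<le> 1 - r\<close>.\<close>
  also have "\<dots> \<le> d"
    using mult_left_mono[of "r * 3" 1 d] r \<open>d \<ge> 0\<close> by (simp add: divide_simps algebra_simps)
  finally have "(\<Sum>n. c n) \<le> Re (trace_op S)"
    using suminf_split_head[of c] summ c0 by (simp add: summable_Suc_iff d_def)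
  thus ?thesis using summ unfolding bohr_ineq_def c_def[symmetric] by (simp add: summable_Suc_iff)
qed

section \<open>Finite-rank diagonal operators\<close>

definition diag_op :: "(nat \<Rightarrow> 'h::complex_hilbert) \<Rightarrow> nat \<Rightarrow> (nat \<Rightarrow> complex) \<Rightarrow> 'h \<Rightarrow> 'h" where
  "diag_op e n a x = (\<Sum>k<n. (a k * cinner x (e k)) *\<^sub>C e k)"

lemma bounded_op_sum:
  assumes "\<And>i. i \<in> I \<Longrightarrow> bounded_op (A i)"
  shows "bounded_op (\<lambda>x. \<Sum>i\<in>I. A i x)"
  using assms unfolding bounded_op_def by (auto intro!: bounded_linear_sum simp: cvs.scale_sum_right)

lemma bounded_op_diag: "bounded_op (diag_op e n a)"
proof -
  have "bounded_op (\<lambda>x. \<Sum>k<n. cinner x (e k) *\<^sub>C a k *\<^sub>C e k)"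
    by (intro bounded_op_sum bounded_op_rank_one)
  thus ?thesis by (simp add: diag_op_def[abs_def] scaleC_scaleC mult.commute)
qed

lemma diag_op_add: "diag_op e n a x + diag_op e n b x = diag_op e n (\<lambda>k. a k + b k) x"
  by (simp add: diag_op_def distrib_right scaleC_add_left sum.distrib)

lemma diag_op_diff: "diag_op e n a x - diag_op e n b x = diag_op e n (\<lambda>k. a k - b k) x"
  by (simp add: diag_op_def left_diff_distrib cvs.scale_left_diff_distrib sum_subtractf)

lemma diag_op_scale: "c *\<^sub>C diag_op e n a x = diag_op e n (\<lambda>k. c * a k) x"
  by (simp add: diag_op_def cvs.scale_sum_right scaleC_scaleC mult.assoc)

lemma cinner_diag_left: "cinner (diag_op e n a x) y = (\<Sum>k<n. a k * cinner x (e k) * cinner (e k) y)"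
  by (simp add: diag_op_def cinner_simps)

lemma cadjoint_diag: "cadjoint (diag_op e n a) = diag_op e n (\<lambda>k. cnj (a k))"
proof (rule cadjoint_unique)
  fix x y
  have "cinner x (diag_op e n (\<lambda>k. cnj (a k)) y) = (\<Sum>k<n. a k * (cinner x (e k) * cinner (e k) y))"
    by (simp add: diag_op_def cinner_simps mult_ac flip: cinner_commute)
  thus "cinner (diag_op e n a x) y = cinner x (diag_op e n (\<lambda>k. cnj (a k)) y)"
    by (simp add: cinner_diag_left mult.assoc)
qed

lemma re_op_diag: "re_op (diag_op e n a) = diag_op e n (\<lambda>k. of_real (Re (a k)))"
  by (simp add: fun_eq_iff re_op_def cadjoint_diag diag_op_add diag_op_scale complex_add_cnj)

lemma positive_op_diag:
  assumes "\<And>k. k < n \<Longrightarrow> 0 \<le> a k"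
  shows "positive_op (diag_op e n (\<lambda>k. complex_of_real (a k)))"
proof -
  have "cinner (diag_op e n (\<lambda>k. complex_of_real (a k)) x) x =
      of_real (\<Sum>k<n. a k * (cmod (cinner x (e k)))\<^sup>2)" for x
    unfolding cinner_diag_left mult.assoc cinner_mult_cinner_commuted by simp
  thus ?thesis using assms by (auto simp: positive_op_def bounded_op_diag intro!: sum_nonneg)
qed

context
  fixes e :: "nat \<Rightarrow> 'h::complex_hilbert" and n :: nat
  assumes e: "\<And>i j. i < n \<Longrightarrow> j < n \<Longrightarrow> cinner (e i) (e j) = (if i = j then 1 else 0)"
begin

lemma diag_op_compose: "diag_op e n a \<circ> diag_op e n b = diag_op e n (\<lambda>k. a k * b k)"
proof
  fix x
  have "cinner (diag_op e n b x) (e j) = b j * cinner x (e j)" if "j < n" for j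
  proof -
    have "cinner (diag_op e n b x) (e j) = (\<Sum>k<n. if k = j then b k * cinner x (e k) else 0)"
      unfolding cinner_diag_left using e that by (intro sum.cong) auto
    thus ?thesis using that by simp
  qed
  thus "(diag_op e n a \<circ> diag_op e n b) x = diag_op e n (\<lambda>k. a k * b k) x"
    by (simp add: diag_op_def[of e n a] diag_op_def[of e n "\<lambda>k. a k * b k"] mult.assoc)
qed

lemma nuclear_rep_diag:
  "nuclear_rep (diag_op e n a) (\<lambda>k. if k < n then a k *\<^sub>C e k else 0) (\<lambda>k. if k < n then e k else 0)"
  unfolding nuclear_rep_def
proof (intro conjI allI)
  show "summable (\<lambda>k. norm (if k < n then a k *\<^sub>C e k else 0) * norm (if k < n then e k else 0))"
    by (rule summable_finite[of "{..<n}"]) auto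
  fix x
  have "(\<lambda>k. cinner x (if k < n then e k else 0) *\<^sub>C (if k < n then a k *\<^sub>C e k else 0)) sums
      (\<Sum>k<n. cinner x (if k < n then e k else 0) *\<^sub>C (if k < n then a k *\<^sub>C e k else 0))"
    by (rule sums_finite) (auto simp: cinner_simps)
  thus "(\<lambda>k. cinner x (if k < n then e k else 0) *\<^sub>C (if k < n then a k *\<^sub>C e k else 0)) sums
      diag_op e n a x"
    by (simp add: diag_op_def scaleC_scaleC mult.commute)
qed

lemma trace_diag: "trace_op (diag_op e n a) = (\<Sum>k<n. a k)"
proof -
  have "(\<lambda>k. cinner (if k < n then a k *\<^sub>C e k else 0) (if k < n then e k else 0)) sums
      (\<Sum>k<n. cinner (if k < n then a k *\<^sub>C e k else 0) (if k < n then e k else 0))"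
    by (rule sums_finite) (auto simp: cinner_simps)
  thus ?thesis
    unfolding trace_op_nuclear[OF nuclear_rep_diag] using e
    by (simp add: sums_iff cinner_simps)
qed

text \<open>The absolute value is again diagonal, with entries \<open>cmod (a k)\<close>.\<close>

lemma trace_class_diag: "trace_class (diag_op e n a)"
proof -
  let ?P = "diag_op e n (\<lambda>k. complex_of_real (cmod (a k)))"
  have "complex_of_real (cmod z) * complex_of_real (cmod z) = cnj z * z" for z
    using complex_norm_square[of z] by (simp add: power2_eq_square mult.commute)
  hence "is_abs_op ?P (diag_op e n a)"
    unfolding is_abs_op_def cadjoint_diag diag_op_compose by (simp add: positive_op_diag)
  moreover have "(\<lambda>f. cinner (?P f) f) summable_on (SOME E. is_onb E)"
    using has_sum_trace_op[OF nuclear_rep_diag is_onb_some] unfolding summable_on_def by blast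
  ultimately show ?thesis unfolding trace_class_def using bounded_op_diag is_onb_some by blast
qed

text \<open>The squared norm of the image is a sum of squared coefficients with weights at most 1,
  so Bessel's inequality bounds it.\<close>

lemma onorm_diag_le:
  assumes a: "\<And>k. k < n \<Longrightarrow> cmod (a k) \<le> 1"
  shows "onorm (diag_op e n a) \<le> 1"
proof (rule onorm_bound)
  fix x
  have inj: "inj_on e {..<n}"
    by (rule inj_onI) (metis e lessThan_iff one_neq_zero)
  have on: "orthonormal (e ` {..<n})" using e inj by (auto simp: orthonormal_def inj_on_eq_iff)
  have "complex_of_real ((norm (diag_op e n a x))\<^sup>2) = cinner ((diag_op e n (\<lambda>k. cnj (a k)) \<circ> diag_op e n a) x) x"
    using cinner_cadjoint_left[OF bounded_op_diag, of e n a "diag_op e n a x" x]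
    by (simp only: cadjoint_diag cinner_self o_apply)
  also have "\<dots> = of_real (\<Sum>k<n. (cmod (a k))\<^sup>2 * (cmod (cinner x (e k)))\<^sup>2)"
  proof -
    have "cnj z * z = of_real ((cmod z)\<^sup>2)" for z
      unfolding complex_norm_square by (rule mult.commute)
    thus ?thesis
      unfolding diag_op_compose cinner_diag_left by (simp add: mult.assoc[of "_\<^sup>2"] cinner_mult_cinner_commuted)
  qed
  finally have "(norm (diag_op e n a x))\<^sup>2 = (\<Sum>k<n. (cmod (a k))\<^sup>2 * (cmod (cinner x (e k)))\<^sup>2)"
    by (simp only: of_real_eq_iff)
  also have "\<dots> \<le> (\<Sum>k<n. 1 * (cmod (cinner x (e k)))\<^sup>2)"
    using a by (intro sum_mono mult_right_mono) (auto simp: power_le_one)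
  also have "\<dots> = (\<Sum>f\<in>e ` {..<n}. (cmod (cinner x f))\<^sup>2)"
    by (simp add: sum.reindex[OF inj])
  also have "\<dots> \<le> (norm x)\<^sup>2" by (intro bessel on) simp
  finally show "norm (diag_op e n a x) \<le> 1 * norm x" by (auto intro: power2_le_imp_le)
qed simp

end

section \<open>Optimality of 1/3\<close>

lemma obtain_orthonormal_sequence:
  assumes infinite_dim: "\<not> (\<exists>B :: 'h::complex_hilbert set. finite B \<and> cspan B = UNIV)"
  obtains e :: "nat \<Rightarrow> 'h::complex_hilbert" where "\<And>i j. cinner (e i) (e j) = (if i = j then 1 else 0)"
proof -
  obtain E :: "'h set" where E: "is_onb E" using is_onb_some by blast
  then obtain e :: "nat \<Rightarrow> 'h" where e: "inj e" "range e \<subseteq> E"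
    using infinite_countable_subset[OF onb_infinite[OF E infinite_dim]] by blast
  have "cinner (e i) (e j) = (if i = j then 1 else 0)" for i j
    using E rangeI[of e] e(2) inj_eq[OF e(1)] unfolding is_onb_def by (metis subsetD)
  thus ?thesis by (rule that)
qed

text \<open>\<open>A = diag(-1, i, 1 - i)\<close>, \<open>S = diag(0, 0, 1)\<close>, \<open>A\<^sub>n = diag(1, -i, 0)\<close>: here \<open>Tr A = 0\<close>,
  \<open>Tr S = 1\<close> and \<open>\<bar>\<alpha>\<^sub>n\<bar> = 2\<close> for all \<open>n \<ge> 1\<close>.\<close>

lemma bohr_third_optimal:
  assumes infinite_dim: "\<not> (\<exists>B :: 'h::complex_hilbert set. finite B \<and> cspan B = UNIV)"
    and r: "r > 1/3"
  shows "\<exists>(A :: 'h \<Rightarrow> 'h) S An. bohr_hyps A S An \<and> \<not> bohr_ineq A S An r"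
proof -
  obtain e :: "nat \<Rightarrow> 'h" where e: "\<And>i j. cinner (e i) (e j) = (if i = j then 1 else 0)"
    using obtain_orthonormal_sequence[OF infinite_dim] by blast
  \<comment> \<open>List lookups beyond index 2 are unspecified, but only \<open>k < 3\<close>
    matters.\<close>
  define a where "a k = [-1, \<i>, 1 - \<i>] ! k" for k
  define s where "s k = [0, 0, 1 :: real] ! k" for k
  define b where "b k = [1, - \<i>, 0] ! k" for k
  note defs = a_def s_def b_def
  define D where "D = diag_op e 3"
  note trace = trace_diag[of 3 e, OF e, folded D_def]
  note compose = diag_op_compose[of 3 e, OF e, folded D_def]
  have sum3: "(\<Sum>k<3. f k) = f 0 + f (Suc 0) + f (Suc (Suc 0))" for f :: "nat \<Rightarrow> complex"
    by (simp add: numeral_3_eq_3)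
  have less3: "k < 3 \<longleftrightarrow> k = 0 \<or> k = Suc 0 \<or> k = Suc (Suc 0)" for k :: nat by auto
  let ?A = "D a" and ?S = "D (\<lambda>k. of_real (s k))" and ?An = "\<lambda>_::nat. D b"
  \<comment> \<open>The difference is diag(1, 0, 0).\<close>
  have "op_le (re_op ?A) ?S"
    unfolding op_le_def D_def re_op_diag diag_op_diff of_real_diff[symmetric]
    by (rule positive_op_diag) (auto simp: less3 defs)
  moreover have "selfadjoint_op ?S"
    by (simp add: selfadjoint_op_def D_def bounded_op_diag cadjoint_diag)
  moreover have "trace_class (D c)" for c unfolding D_def by (rule trace_class_diag) (rule e)
  moreover have "onorm (D b) \<le> 1"
    unfolding D_def by (rule onorm_diag_le[OF e]) (auto simp: less3 defs)
  moreover have "bounded_op (D b)" unfolding D_def by (rule bounded_op_diag)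
  ultimately have hyps: "bohr_hyps ?A ?S ?An"
    by (simp add: bohr_hyps_def trace compose sum3 defs)
  \<comment> \<open>For positive \<open>n\<close> the coefficient is -1 + \<i> \<i> = -2.\<close>
  have coeff: "cmod (bohr_coeff ?A ?An n) = (if n = 0 then 0 else 2)" for n
    using cadjoint_diag[of e 3 b, folded D_def]
    by (simp add: bohr_coeff_def trace compose sum3 defs)
  have "\<not> bohr_ineq ?A ?S ?An r"
  proof
    assume ineq: "bohr_ineq ?A ?S ?An r"
    define f where "f n = (if n = 0 then 0 else 2) * r ^ n" for n :: nat
    have summ: "summable f" and le: "(\<Sum>n. f n) \<le> 1"
      using ineq by (simp_all add: bohr_ineq_def coeff f_def[abs_def] trace sum3 defs)
    have Suc: "(\<lambda>n. f (Suc n)) = (\<lambda>n. 2 * r * r ^ n)" by (simp add: f_def fun_eq_iff)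
    \<comment> \<open>Convergence is part of the inequality, so it forces \<open>r < 1\<close> and
      the geometric sum can be evaluated.\<close>
    have "summable (\<lambda>n. 2 * r * r ^ n)" using summ Suc summable_Suc_iff[of f] by simp
    hence "r < 1" using r by (simp add: summable_cmult_iff summable_geometric_iff)
    hence "(\<lambda>n. 2 * r * r ^ n) sums (2 * r * (1 / (1 - r)))"
      using r by (intro sums_mult geometric_sums) simp
    hence "(\<Sum>n. f n) = 2 * r * (1 / (1 - r))"
      using suminf_split_head[OF summ] by (simp add: Suc sums_iff f_def[of 0])
    hence "2 * r * (1 / (1 - r)) \<le> 1" using le by simp
    hence "2 * r \<le> 1 - r" using \<open>r < 1\<close> by (simp add: divide_simps)
    thus False using r by simp
  qed
  thus ?thesis using hyps by blast
qed

theorem mainTheorem2: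
  assumes separable: "separable_space (euclidean :: 'h::complex_hilbert topology)"
    and infinite_dim: "\<not> (\<exists>B :: 'h set. finite B \<and> cspan B = UNIV)"
  shows "(\<forall>(A :: 'h \<Rightarrow> 'h) S An r. bohr_hyps A S An \<and> 0 \<le> r \<and> r \<le> 1/3 \<longrightarrow> bohr_ineq A S An r) \<and>
    (\<forall>r > 1/3. \<exists>(A :: 'h \<Rightarrow> 'h) S An. bohr_hyps A S An \<and> \<not> bohr_ineq A S An r)"
  using bohr_ineq_third bohr_third_optimal[OF infinite_dim] by blast

end
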